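(* Let $\widehat W=\widehat W(\lambda,\overline\lambda)$ with $\lambda=a+bi\in\mathbb C\setminus\mathbb R$ and Weyr characteristic $(w_1,\dots,w_m)$, assume $\mathcal P_{(\widehat W;\underline r)}\ne\emptyset$, let $P\in\mathcal P_{(\widehat W;\underline r)}$ and let $\underline{\mathcal I}=(\mathcal I_1,\dots,\mathcal I_m)$ be an admissible sequence of indices for $P$. Then $P$ is $\widetilde C_{\widehat W}$-equivalent to a unique $\widetilde C_{\widehat W}$-reduced form $P^{(\mathrm{re})}\in\mathcal P_{(\widehat W;\underline r)}$ with respect to $\underline{\mathcal I}$.
   Context: Let $w_1\ge\cdots\ge w_m\ge1$ be integers, $s=\sum_iw_i$, $B=\begin{bmatrix}a&b\\-b&a\end{bmatrix}$, and $X^{(p)}=\operatorname{diag}(X,\dots,X)$ ($p$ copies). For $p\ge q$, $I_{p,q}=\begin{bmatrix}I_q\\0\end{bmatrix}\in\mathbb R^{p\times q}$. $\widehat W(\lambda,\overline\lambda)\in\mathbb R^{2s\times2s}$ is the block matrix with diagonal blocks $B^{(w_1)},\dots,B^{(w_m)}$, $(i,i+1)$ blocks $I_{2w_i,2w_{i+1}}$, and all other blocks zero. Put $\tau_0=0$, $\tau_i=w_{m-i+1}$, $1\le i\le m$ (so $\tau_m=w_1$; some differences $\tau_i-\tau_{i-1}$ may be $0$, giving empty blocks). Let $\underline r:\ r=r_1\ge\cdots\ge r_k>0$ be integers. $\mathcal P_{(\widehat W;\underline r)}$ is the set of matrices $P=\begin{bmatrix}P_1\\ \vdots\\P_k\end{bmatrix}$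 with $\operatorname{rank}P=2s$, $P_1\in\mathbb R^{r\times 2s}$ and $P_i\in\mathbb R^{r_i\times 2s}$ equal to the first $r_i$ rows of $P_1\widehat W^{i-1}$. $\widetilde C_{\widehat W}$ is the group of invertible real matrices commuting with $\widehat W$; $P,\widehat P$ are $\widetilde C_{\widehat W}$-equivalent if $\widehat P=PX$ for some $X\in\widetilde C_{\widehat W}$. For $z=[z_1\ z_2]\in\mathbb R^{1\times2}$ put $z^\diamond=\begin{bmatrix}z_1&z_2\\-z_2&z_1\end{bmatrix}$; for $Z=[z_{ij}]\in\mathbb R^{p\times2q}$ with $z_{ij}\in\mathbb R^{1\times2}$ put $Z^\diamond=[z_{ij}^\diamond]\in\mathbb R^{2p\times2q}$. $A(I,J)$ denotes the submatrix of $A$ with rows in $I$ and columns in $J$ (in the listed order); $A(I,:)$ uses all columns. $Q_{l,p}$ is the set of strictly increasing sequences of length $l$ in $\{1,\dots,p\}$, $Q_{0,p}=\{\emptyset\}$. An admissible sequence of indices for $P$ is $\underline{\mathcal I}=(\mathcal I_1,\dots,\mathcal I_m)$ where $\mathcal I_j=(i_1,\dots,i_{\tau_j})$ is a sequence of $\tau_j$ distinct indices in $\{1,\dots,r\}$ such that $\mathcal I_j\subseteq\mathcal I_{j+1}$ (as an initial segment), $\mathcal I_j\setminus\mathcal I_{j-1}=(i_{\tau_{j-1}+1},\dots,i_{\tau_j})\in Q_{\tau_j-\tau_{j-1},r}$ ($\mathcal I_0=\emptyset$), and $P(\mathcal I_j,1{:}2\tau_j)^\diamond\in\mathbb R^{2\tau_j\times2\tau_j}$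 is invertible, $1\le j\le m$. A matrix $R\in\mathcal P_{(\widehat W;\underline r)}$ with first block $R_1=[R_{11}\ \cdots\ R_{1m}]$, $R_{1j}\in\mathbb R^{r\times2w_j}$, is a $\widetilde C_{\widehat W}$-reduced form (of $P$) with respect to $\underline{\mathcal I}$ if, partitioning for each $j$ the matrix $R_{1j}(\mathcal I_m,:)\in\mathbb R^{w_1\times2w_j}$ into blocks $R^{(j)}_{ik}\in\mathbb R^{(\tau_i-\tau_{i-1})\times2(\tau_k-\tau_{k-1})}$, $1\le i\le m$, $1\le k\le m-j+1$, one has: $R_{ii}^{(1)\diamond}=I_{2(\tau_i-\tau_{i-1})}$ for $1\le i\le m$; $R^{(1)\diamond}_{ik}=0$ for $1\le i<k\le m$; and $R^{(j)\diamond}_{ik}=0$ for $2\le j\le m$, $1\le i\le m$, $\max\{i-j+1,1\}\le k\le m-j+1$. The uniqueness asserts that exactly one such $R$ is $\widetilde C_{\widehat W}$-equivalent to $P$. *)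

theory Defs
  imports
    "HOL-Library.Sublist"
    "Jordan_Normal_Form.DL_Rank"
begin

text \<open>
  Families of block sizes, blocks and the Weyr characteristic are indexed from 1, as functions on
  \<^typ>\<open>nat\<close> of which only the values at \<open>1, \<dots>, m\<close> matter. Rows and columns of matrices are
  indexed from 0, as in the matrix library; in particular the row indices that the
  mathematical text takes from \<open>1, \<dots>, r\<close> are here taken from \<open>0, \<dots>, r - 1\<close>.
\<close>

definition noninc_pos_seq :: "nat \<Rightarrow> (nat \<Rightarrow> nat) \<Rightarrow> bool" where
  "noninc_pos_seq m w \<longleftrightarrow> 1 \<le> m \<and> antimono_on {1..m} w \<and> (\<forall>i\<in>{1..m}. 1 \<le> w i)"

subsection \<open>Submatrices and block matrices\<close>

text \<open>\<open>A(I,J)\<close>. The library's \<open>submatrix\<close> takes index sets and hence loses the order.\<close>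

definition submat :: "'a mat \<Rightarrow> nat list \<Rightarrow> nat list \<Rightarrow> 'a mat" where
  "submat A I J = mat (length I) (length J) (\<lambda>(i, j). A $$ (I ! i, J ! j))"

definition offset :: "(nat \<Rightarrow> nat) \<Rightarrow> nat \<Rightarrow> nat" where
  "offset n i = (\<Sum>l = 1..<i. n l)"

definition block_range :: "(nat \<Rightarrow> nat) \<Rightarrow> nat \<Rightarrow> nat list" where
  "block_range n i = [offset n i ..< offset n (Suc i)]"

text \<open>The \<open>(i, k)\<close> block of a matrix partitioned with row sizes \<open>p\<close> and column sizes \<open>q\<close>.\<close>

definition block :: "(nat \<Rightarrow> nat) \<Rightarrow> (nat \<Rightarrow> nat) \<Rightarrow> 'a mat \<Rightarrow> nat \<Rightarrow> nat \<Rightarrow> 'a mat" where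
  "block p q A i k = submat A (block_range p i) (block_range q k)"

text \<open>The block containing the row (or column) with index \<open>x\<close>.\<close>

definition block_of :: "(nat \<Rightarrow> nat) \<Rightarrow> nat \<Rightarrow> nat" where
  "block_of n x = (LEAST i. x < offset n (Suc i))"

text \<open>The \<open>m \<times> m\<close> block matrix with diagonal block sizes \<open>n 1, \<dots>, n m\<close> and \<open>(i, k)\<close> block \<open>F i k\<close>.\<close>

definition of_blocks :: "nat \<Rightarrow> (nat \<Rightarrow> nat) \<Rightarrow> (nat \<Rightarrow> nat \<Rightarrow> 'a mat) \<Rightarrow> 'a mat" where
  "of_blocks m n F = mat (offset n (Suc m)) (offset n (Suc m)) (\<lambda>(x, y).
     let i = block_of n x; k = block_of n y in F i k $$ (x - offset n i, y - offset n k))"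

lemma offset_Suc: "1 \<le> i \<Longrightarrow> offset n (Suc i) = offset n i + n i"
  by (simp add: offset_def)

lemma offset_mono: "i \<le> k \<Longrightarrow> offset n i \<le> offset n k"
  unfolding offset_def by (intro sum_mono2) auto

lemma block_of_eq:
  assumes "1 \<le> i" and "x < n i"
  shows "block_of n (offset n i + x) = i"
  unfolding block_of_def
proof (rule Least_equality)
  show "offset n i + x < offset n (Suc i)" using assms by (simp add: offset_Suc)
next
  fix k assume "offset n i + x < offset n (Suc k)"
  then show "i \<le> k" using offset_mono[of "Suc k" i n] by (cases "Suc k \<le> i") auto
qed

lemma block_of_blocks:
  assumes "i \<in> {1..m}" and "k \<in> {1..m}" and "F i k \<in> carrier_mat (n i) (n k)"
  shows "block n n (of_blocks m n F) i k = F i k"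
proof (rule eq_matI)
  fix x y assume "x < dim_row (F i k)" and "y < dim_col (F i k)"
  with assms have x: "x < n i" and y: "y < n k" by auto
  have "offset n i + x < offset n (Suc m)" "offset n k + y < offset n (Suc m)"
    using assms x y offset_mono[of "Suc i" "Suc m" n] offset_mono[of "Suc k" "Suc m" n]
    by (auto simp: offset_Suc)
  then show "block n n (of_blocks m n F) i k $$ (x, y) = F i k $$ (x, y)"
    using assms x y
    by (simp add: block_def submat_def block_range_def of_blocks_def offset_Suc block_of_eq)
qed (use assms in \<open>auto simp: block_def submat_def block_range_def offset_Suc\<close>)

subsection \<open>Real Weyr matrices for a pair of non-real conjugate eigenvalues\<close>

definition cell :: "real \<Rightarrow> real \<Rightarrow> real mat" where
  "cell a b = mat_of_rows_list 2 [[a, b], [- b, a]]"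

definition copies :: "nat \<Rightarrow> 'a::zero mat \<Rightarrow> 'a mat" where
  "copies p X = diag_block_mat (replicate p X)"

text \<open>\<open>I\<^bsub>p,q\<^esub>\<close>, for \<open>p \<ge> q\<close>.\<close>

definition tall_id :: "nat \<Rightarrow> nat \<Rightarrow> real mat" where
  "tall_id p q = 1\<^sub>m q @\<^sub>r 0\<^sub>m (p - q) q"

definition real_weyr :: "complex \<Rightarrow> nat \<Rightarrow> (nat \<Rightarrow> nat) \<Rightarrow> real mat" where
  "real_weyr \<mu> m w = of_blocks m (\<lambda>i. 2 * w i) (\<lambda>i k.
     if k = i then copies (w i) (cell (Re \<mu>) (Im \<mu>))
     else if k = i + 1 then tall_id (2 * w i) (2 * w k)
     else 0\<^sub>m (2 * w i) (2 * w k))"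

definition tau :: "nat \<Rightarrow> (nat \<Rightarrow> nat) \<Rightarrow> nat \<Rightarrow> nat" where
  "tau m w i = (if i = 0 then 0 else w (m - i + 1))"

definition tau_diff :: "nat \<Rightarrow> (nat \<Rightarrow> nat) \<Rightarrow> nat \<Rightarrow> nat" where
  "tau_diff m w i = tau m w i - tau m w (i - 1)"

definition diamond :: "real mat \<Rightarrow> real mat" where
  "diamond Z = mat (2 * dim_row Z) (2 * (dim_col Z div 2)) (\<lambda>(i, j).
     cell (Z $$ (i div 2, 2 * (j div 2))) (Z $$ (i div 2, 2 * (j div 2) + 1)) $$ (i mod 2, j mod 2))"

subsection \<open>The set of matrices and the group acting on it\<close>

text \<open>The block \<open>P\<^sub>i\<close> of a matrix whose rows are partitioned with sizes \<open>r 1, r 2, \<dots>\<close>\<close>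

definition row_block :: "(nat \<Rightarrow> nat) \<Rightarrow> 'a mat \<Rightarrow> nat \<Rightarrow> 'a mat" where
  "row_block r P i = submat P (block_range r i) [0..<dim_col P]"

definition obs_mats :: "real mat \<Rightarrow> nat \<Rightarrow> (nat \<Rightarrow> nat) \<Rightarrow> real mat set" where
  "obs_mats W k r = {P \<in> carrier_mat (\<Sum>i = 1..k. r i) (dim_col W).
     vec_space.rank (dim_row P) P = dim_col W \<and>
     (\<forall>i\<in>{1..k}. row_block r P i =
        submat (row_block r P 1 * W ^\<^sub>m (i - 1)) [0..<r i] [0..<dim_col W])}"

definition centralizer_group :: "real mat \<Rightarrow> real mat set" where
  "centralizer_group W =
     {X \<in> carrier_mat (dim_row W) (dim_row W). invertible_mat X \<and> X * W = W * X}"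

definition centralizer_equiv :: "real mat \<Rightarrow> real mat \<Rightarrow> real mat \<Rightarrow> bool" where
  "centralizer_equiv W P P' \<longleftrightarrow> (\<exists>X\<in>centralizer_group W. P' = P * X)"

subsection \<open>Admissible sequences of indices and reduced forms\<close>

definition incr_seqs :: "nat \<Rightarrow> nat \<Rightarrow> nat list set" where
  "incr_seqs l p = {xs. length xs = l \<and> set xs \<subseteq> {..<p} \<and> sorted_wrt (<) xs}"

text \<open>\<open>\<I> j\<close> is the list \<open>(i\<^sub>1, \<dots>, i\<^bsub>\<tau>\<^sub>j\<^esub>)\<close>, so that dropping its first \<open>\<tau>\<^bsub>j-1\<^esub>\<close>
  entries yields \<open>\<I>\<^sub>j \ \<I>\<^bsub>j-1\<^esub>\<close>.\<close>

definition admissible ::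
    "nat \<Rightarrow> (nat \<Rightarrow> nat) \<Rightarrow> nat \<Rightarrow> real mat \<Rightarrow> (nat \<Rightarrow> nat list) \<Rightarrow> bool" where
  "admissible m w r P \<I> \<longleftrightarrow>
     (\<forall>j\<in>{1..m}.
        length (\<I> j) = tau m w j \<and> distinct (\<I> j) \<and> set (\<I> j) \<subseteq> {..<r} \<and>
        drop (tau m w (j - 1)) (\<I> j) \<in> incr_seqs (tau_diff m w j) r \<and>
        invertible_mat (diamond (submat P (\<I> j) [0..<2 * tau m w j]))) \<and>
     (\<forall>j\<in>{1..<m}. prefix (\<I> j) (\<I> (j + 1)))"

text \<open>The block \<open>R\<^sup>(\<^sup>j\<^sup>)\<^bsub>ik\<^esub>\<close> of \<open>R\<^bsub>1j\<^esub>(\<I>\<^sub>m, :)\<close>, where \<open>R1\<close> is the first row block of \<open>R\<close>.\<close>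

definition red_block ::
    "nat \<Rightarrow> (nat \<Rightarrow> nat) \<Rightarrow> (nat \<Rightarrow> nat list) \<Rightarrow> real mat \<Rightarrow> nat \<Rightarrow> nat \<Rightarrow> nat \<Rightarrow> real mat" where
  "red_block m w \<I> R1 j i k =
     block (tau_diff m w) (\<lambda>l. 2 * tau_diff m w l)
       (submat R1 (\<I> m) (block_range (\<lambda>l. 2 * w l) j)) i k"

definition reduced_form ::
    "complex \<Rightarrow> nat \<Rightarrow> (nat \<Rightarrow> nat) \<Rightarrow> nat \<Rightarrow> (nat \<Rightarrow> nat) \<Rightarrow> (nat \<Rightarrow> nat list) \<Rightarrow> real mat \<Rightarrow> bool"
  where
  "reduced_form \<mu> m w k r \<I> R \<longleftrightarrow>
     R \<in> obs_mats (real_weyr \<mu> m w) k r \<and>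
     (let d = tau_diff m w; R' = red_block m w \<I> (row_block r R 1) in
       (\<forall>i\<in>{1..m}. diamond (R' 1 i i) = 1\<^sub>m (2 * d i)) \<and>
       (\<forall>i\<in>{1..m}. \<forall>l\<in>{i<..m}. diamond (R' 1 i l) = 0\<^sub>m (2 * d i) (2 * d l)) \<and>
       (\<forall>j\<in>{2..m}. \<forall>i\<in>{1..m}. \<forall>l\<in>{max (i + 1 - j) 1..m - j + 1}.
          diamond (R' j i l) = 0\<^sub>m (2 * d i) (2 * d l)))"

end

theory Submission imports Defs begin

text \<open>
  Identify a pair of real columns with one complex column, so that cells \<open>z\<^sup>\<diamond>\<close> become complex numbers.
  Since \<open>\<mu>\<close> is not real, a real matrix commuting with the Weyr matrix consists of such cells; it thus
  corresponds to a complex matrix \<open>Y\<close> commuting with the nilpotent part, and such a \<open>Y\<close> is determined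
  by its first block row. Let \<open>height y\<close> be the number of blocks that have a column \<open>y\<close>. The first block
  row is free exactly in those entries \<open>(x, (j, y))\<close> with \<open>height y < height x + j\<close>,
  and these are exactly the positions where the reduced form prescribes the entries of \<open>P Y\<close>. For fixed
  \<open>(j, y)\<close> the unknown entries solve a square linear system whose matrix is a leading block
  of the selected rows of \<open>P\<close>, invertible by admissibility, and whose right-hand side involves
  only the columns of \<open>Y\<close> in blocks before \<open>j\<close>. Hence \<open>Y\<close> exists and is unique. The
  product of the leading blocks of the selected rows of \<open>P\<close> and of \<open>Y\<close> is lower unitriangular, so
  \<open>Y\<close> is invertible.
\<close>

subsection \<open>Realification of complex matrices\<close>

lemma sum_lessThan_add:
  fixes f :: "nat \<Rightarrow> 'a::comm_monoid_add"
  shows "sum f {..<a + b} = sum f {..<a} + (\<Sum>z<b. f (a + z))"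
  by (induction b) (simp_all add: ac_simps)

lemma sum_lessThan_double:
  fixes f :: "nat \<Rightarrow> 'a::comm_monoid_add"
  shows "sum f {..<2 * n} = (\<Sum>p<n. f (2 * p) + f (2 * p + 1))"
  by (induction n) (simp_all add: ac_simps)

lemma offset_one: "offset n (Suc 0) = 0"
  by (simp add: offset_def)

lemma offset_double: "offset (\<lambda>i. 2 * n i) i = 2 * offset n i"
  by (simp add: offset_def sum_distrib_left)

lemma sum_offset:
  fixes f :: "nat \<Rightarrow> 'a::comm_monoid_add"
  shows "sum f {..<offset n (Suc m)} = (\<Sum>i=1..m. \<Sum>z<n i. f (offset n i + z))"
  by (induction m) (simp_all add: offset_one offset_Suc sum_lessThan_add)

lemma offset_add_less:
  assumes "i \<in> {1..m}" "z < n i"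
  shows "offset n i + z < offset n (Suc m)"
  using assms offset_mono[of "Suc i" "Suc m" n] by (auto simp: offset_Suc)

lemma offset_cases:
  assumes "x < offset n (Suc m)"
  obtains i z where "i \<in> {1..m}" "z < n i" "x = offset n i + z"
  using assms
proof (induction m arbitrary: thesis)
  case 0
  then show ?case by (simp add: offset_one)
next
  case (Suc m)
  show ?case
  proof (cases "x < offset n (Suc m)")
    case True
    then obtain i z where "i \<in> {1..m}" "z < n i" "x = offset n i + z"
      using Suc.IH by blast
    then show ?thesis using Suc.prems(1)[of i z] by auto
  next
    case False
    then have "x = offset n (Suc m) + (x - offset n (Suc m))" by simp
    moreover have "x - offset n (Suc m) < n (Suc m)"
      using False Suc.prems(2) by (simp add: offset_Suc)
    ultimately show ?thesis using Suc.prems(1)[of "Suc m"] by auto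
  qed
qed

section \<open>Entries of cells and of the blocks that make up the Weyr matrix\<close>

lemma cell_index [simp]:
  "cell a b $$ (0, 0) = a" "cell a b $$ (0, Suc 0) = b"
  "cell a b $$ (Suc 0, 0) = - b" "cell a b $$ (Suc 0, Suc 0) = a"
  by (simp_all add: cell_def mat_of_rows_list_def)

lemma cell_carrier: "cell a b \<in> carrier_mat 2 2"
  by (auto simp: cell_def mat_of_rows_list_def)

lemma copies_carrier:
  assumes "X \<in> carrier_mat 2 2"
  shows "copies p X \<in> carrier_mat (2 * p) (2 * p)"
  using assms by (induction p) (auto simp: copies_def Let_def)

lemma copies_index:
  assumes "X \<in> carrier_mat 2 2" "x < 2 * p" "y < 2 * p"
  shows "copies p X $$ (x, y) = (if x div 2 = y div 2 then X $$ (x mod 2, y mod 2) else 0)"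
  using assms(2,3)
proof (induction p arbitrary: x y)
  case (Suc p)
  let ?C = "copies p X"
  have C: "?C \<in> carrier_mat (2 * p) (2 * p)"
    using copies_carrier[OF assms(1)] .
  have "copies (Suc p) X $$ (x, y) = four_block_mat X (0\<^sub>m 2 (2 * p)) (0\<^sub>m (2 * p) 2) ?C $$ (x, y)"
    using assms(1) C by (simp add: copies_def Let_def)
  also have "\<dots> = (if x < 2 then if y < 2 then X $$ (x, y) else 0
      else if y < 2 then 0 else ?C $$ (x - 2, y - 2))"
    using assms(1) C Suc.prems by (subst index_mat_four_block) auto
  also have "\<dots> = (if x div 2 = y div 2 then X $$ (x mod 2, y mod 2) else 0)"
  proof (cases "x < 2 \<or> y < 2")
    case True
    then show ?thesis by (auto simp: div_eq_0_iff)
  next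
    case False
    then obtain x' y' where "x = x' + 2" "y = y' + 2"
      by (metis add.commute le_add_diff_inverse not_less)
    then show ?thesis using Suc.IH[of x' y'] Suc.prems by simp
  qed
  finally show ?case .
qed simp

lemma tall_id_index:
  assumes "q \<le> p" "x < p" "y < q"
  shows "tall_id p q $$ (x, y) = (if x = y then 1 else 0)"
  using assms by (auto simp: tall_id_def append_rows_def)

text \<open>Only columns are paired: \<open>x\<close> stays a real row index while \<open>y\<close>
  counts pairs, so the complex entries of a matrix made of cells are read at rows
  \<open>2 * x\<close>.\<close>

definition cx :: "real mat \<Rightarrow> nat \<Rightarrow> nat \<Rightarrow> complex" where
  "cx Z x y = Complex (Z $$ (x, 2 * y)) (Z $$ (x, 2 * y + 1))"

text \<open>The ring embedding of complex matrices into real ones that sends a + bi to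
  \<open>cell a b\<close>. Complex matrices are plain functions, of which only the values below
  \<open>p\<close> and \<open>q\<close> matter.\<close>

definition realify :: "nat \<Rightarrow> nat \<Rightarrow> (nat \<Rightarrow> nat \<Rightarrow> complex) \<Rightarrow> real mat" where
  "realify p q a = mat (2 * p) (2 * q) (\<lambda>(i, j).
     cell (Re (a (i div 2) (j div 2))) (Im (a (i div 2) (j div 2))) $$ (i mod 2, j mod 2))"

lemma realify_carrier [simp]:
  "realify p q a \<in> carrier_mat (2 * p) (2 * q)"
  "dim_row (realify p q a) = 2 * p" "dim_col (realify p q a) = 2 * q"
  by (simp_all add: realify_def)

lemma realify_index:
  assumes "x < p" "y < q"
  shows "realify p q a $$ (2 * x, 2 * y) = Re (a x y)"
    "realify p q a $$ (2 * x, 2 * y + 1) = Im (a x y)"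
    "realify p q a $$ (2 * x + 1, 2 * y) = - Im (a x y)"
    "realify p q a $$ (2 * x + 1, 2 * y + 1) = Re (a x y)"
  using assms by (simp_all add: realify_def)

lemma less_double_cases:
  fixes i :: nat
  assumes "i < 2 * n"
  obtains x where "x < n" "i = 2 * x" | x where "x < n" "i = 2 * x + 1"
proof (cases "even i")
  case True
  then show ?thesis using that(1)[of "i div 2"] assms by auto
next
  case False
  then show ?thesis using that(2)[of "i div 2"] assms by auto
qed

lemma realify_eqI:
  assumes "X \<in> carrier_mat (2 * p) (2 * q)"
    and "\<And>x y. x < p \<Longrightarrow> y < q \<Longrightarrow> X $$ (2 * x, 2 * y) = Re (a x y)
      \<and> X $$ (2 * x, 2 * y + 1) = Im (a x y)
      \<and> X $$ (2 * x + 1, 2 * y) = - Im (a x y) \<and> X $$ (2 * x + 1, 2 * y + 1) = Re (a x y)"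
  shows "X = realify p q a"
proof (rule eq_matI)
  fix i j assume "i < dim_row (realify p q a)" "j < dim_col (realify p q a)"
  then have "i < 2 * p" "j < 2 * q" by simp_all
  then show "X $$ (i, j) = realify p q a $$ (i, j)"
    by (elim less_double_cases) (use assms(2) in \<open>simp_all add: realify_index del: One_nat_def add_Suc_right\<close>)
qed (use assms(1) in auto)

lemma realify_cong:
  assumes "\<And>x y. x < p \<Longrightarrow> y < q \<Longrightarrow> a x y = b x y"
  shows "realify p q a = realify p q b"
  by (intro realify_eqI) (simp_all add: realify_index assms del: One_nat_def add_Suc_right)

lemma cx_realify: "x < p \<Longrightarrow> y < q \<Longrightarrow> cx (realify p q a) (2 * x) y = a x y"
  by (simp add: cx_def realify_index del: One_nat_def add_Suc_right)

lemma realify_eq_iff: "realify p q a = realify p q b \<longleftrightarrow> (\<forall>x<p. \<forall>y<q. a x y = b x y)"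
  using realify_cong cx_realify by metis

lemma diamond_eq_realify:
  assumes "Z \<in> carrier_mat p (2 * q)"
  shows "diamond Z = realify p q (cx Z)"
  using assms by (auto simp: diamond_def realify_def cx_def)

lemma one_mat_eq_realify: "1\<^sub>m (2 * n) = realify n n (\<lambda>x y. if x = y then 1 else 0)"
proof (rule realify_eqI)
  fix x y assume "x < n" "y < n"
  moreover have "2 * x \<noteq> 2 * y + 1" "2 * x + 1 \<noteq> 2 * y" by presburger+
  ultimately show "1\<^sub>m (2 * n) $$ (2 * x, 2 * y) = Re (if x = y then 1 else 0) \<and>
      1\<^sub>m (2 * n) $$ (2 * x, 2 * y + 1) = Im (if x = y then 1 else 0) \<and>
      1\<^sub>m (2 * n) $$ (2 * x + 1, 2 * y) = - Im (if x = y then 1 else 0) \<and>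
      1\<^sub>m (2 * n) $$ (2 * x + 1, 2 * y + 1) = Re (if x = y then 1 else 0)"
    by simp
qed simp

lemma zero_mat_eq_realify: "0\<^sub>m (2 * p) (2 * q) = realify p q (\<lambda>x y. 0)"
  by (rule realify_eqI) auto

text \<open>A row [z1 z2] times the cell of c is the row of the complex number (z1 + i z2) c. Only
  the right factor has to be a realification, so this applies to \<open>P\<close> itself.\<close>

lemma mult_realify_index:
  assumes "A \<in> carrier_mat n (2 * p)" "x < n" "y < q"
  shows "cx (A * realify p q a) x y = (\<Sum>z<p. cx A x z * a z y)"
proof -
  have *: "(A * realify p q a) $$ (x, j) = (\<Sum>z<p. A $$ (x, 2 * z) * realify p q a $$ (2 * z, j) +
      A $$ (x, 2 * z + 1) * realify p q a $$ (2 * z + 1, j))" if "j < 2 * q" for j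
    using assms that
    by (simp add: scalar_prod_def sum_lessThan_double atLeast0LessThan del: One_nat_def)
  have "2 * y < 2 * q" "2 * y + 1 < 2 * q" using assms(3) by simp_all
  note D = this[THEN *]
  show ?thesis
    unfolding cx_def[of "A * realify p q a"] D
  proof (rule complex_eqI; unfold complex.sel Re_sum Im_sum; intro sum.cong refl)
    fix z assume "z \<in> {..<p}"
    then show "A $$ (x, 2 * z) * realify p q a $$ (2 * z, 2 * y) +
        A $$ (x, 2 * z + 1) * realify p q a $$ (2 * z + 1, 2 * y) = Re (cx A x z * a z y)"
      "A $$ (x, 2 * z) * realify p q a $$ (2 * z, 2 * y + 1) +
        A $$ (x, 2 * z + 1) * realify p q a $$ (2 * z + 1, 2 * y + 1) = Im (cx A x z * a z y)"
      using assms(3) by (simp_all add: cx_def realify_index del: One_nat_def add_Suc_right)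
  qed
qed

text \<open>The kernel of \<open>realify n n a\<close> on column vectors is that of \<open>a\<close> via \<open>u \<mapsto> cnj u\<close>.\<close>

lemma det_realify_nonzero_iff:
  "det (realify n n a) \<noteq> 0 \<longleftrightarrow>
    (\<forall>u. (\<forall>x<n. (\<Sum>z<n. a x z * u z) = 0) \<longrightarrow> (\<forall>z<n. u z = 0))"
proof -
  have eq: "realify n n a *\<^sub>v v = 0\<^sub>v (2 * n) \<longleftrightarrow>
      (\<forall>x<n. (\<Sum>z<n. a x z * Complex (v $ (2 * z)) (- v $ (2 * z + 1))) = 0)"
      (is "_ \<longleftrightarrow> ?thesis_rhs")
    if v: "v \<in> carrier_vec (2 * n)" for v
  proof -
    have *: "(realify n n a *\<^sub>v v) $ i = (\<Sum>z<n. realify n n a $$ (i, 2 * z) * v $ (2 * z) +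
        realify n n a $$ (i, 2 * z + 1) * v $ (2 * z + 1))" if "i < 2 * n" for i
      using v that
      by (simp add: scalar_prod_def sum_lessThan_double atLeast0LessThan del: One_nat_def)
    \<comment> \<open>On columns, the cell of c sends (v1, v2) to the real part and the negated
      imaginary part of c (v1 - i v2).\<close>
    have **: "(\<Sum>z<n. a x z * Complex (v $ (2 * z)) (- v $ (2 * z + 1))) =
       Complex ((realify n n a *\<^sub>v v) $ (2 * x)) (- (realify n n a *\<^sub>v v) $ (2 * x + 1))"
      if "x < n" for x
    proof (rule complex_eqI)
      have "2 * x < 2 * n" "2 * x + 1 < 2 * n" using that by simp_all
      note D = this[THEN *]
      show "Re (\<Sum>z<n. a x z * Complex (v $ (2 * z)) (- v $ (2 * z + 1))) =
          Re (Complex ((realify n n a *\<^sub>v v) $ (2 * x)) (- (realify n n a *\<^sub>v v) $ (2 * x + 1)))"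
        unfolding D(1) complex.sel Re_sum
        by (rule sum.cong) (use that in \<open>simp_all add: realify_index del: One_nat_def add_Suc_right\<close>)
      show "Im (\<Sum>z<n. a x z * Complex (v $ (2 * z)) (- v $ (2 * z + 1))) =
          Im (Complex ((realify n n a *\<^sub>v v) $ (2 * x)) (- (realify n n a *\<^sub>v v) $ (2 * x + 1)))"
        unfolding D(2) complex.sel Im_sum sum_negf[symmetric]
        by (rule sum.cong) (use that in \<open>simp_all add: realify_index del: One_nat_def add_Suc_right\<close>)
    qed
    have "realify n n a *\<^sub>v v = 0\<^sub>v (2 * n) \<longleftrightarrow>
        (\<forall>x<n. (realify n n a *\<^sub>v v) $ (2 * x) = 0 \<and>
          (realify n n a *\<^sub>v v) $ (2 * x + 1) = 0)"
      (is "?L \<longleftrightarrow> ?R")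
    proof
      assume ?R
      show ?L
      proof (rule eq_vecI)
        fix i assume "i < dim_vec (0\<^sub>v (2 * n) :: real vec)"
        then have "i < 2 * n" by simp
        then show "(realify n n a *\<^sub>v v) $ i = 0\<^sub>v (2 * n) $ i"
          by (elim less_double_cases) (use \<open>?R\<close> in simp_all)
      qed simp
    qed simp
    also have "\<dots> \<longleftrightarrow> ?thesis_rhs"
    proof -
      have "(\<Sum>z<n. a x z * Complex (v $ (2 * z)) (- v $ (2 * z + 1))) = 0 \<longleftrightarrow>
          (realify n n a *\<^sub>v v) $ (2 * x) = 0 \<and> (realify n n a *\<^sub>v v) $ (2 * x + 1) = 0"
        if "x < n" for x
        unfolding **[OF that] by (simp only: complex_eq_iff complex.sel zero_complex.sel neg_equal_0_iff_equal)
      then show ?thesis by blast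
    qed
    finally show ?thesis .
  qed
  show ?thesis
  proof (intro iffI allI impI)
    fix u z assume "det (realify n n a) \<noteq> 0"
      and u: "\<forall>x<n. (\<Sum>z<n. a x z * u z) = 0" and z: "z < n"
    define v where "v = vec (2 * n) (\<lambda>i. if even i then Re (u (i div 2)) else - Im (u (i div 2)))"
    have vu: "Complex (v $ (2 * z)) (- v $ (2 * z + 1)) = u z" if "z < n" for z
      using that by (simp add: v_def)
    have v: "v \<in> carrier_vec (2 * n)" by (simp add: v_def)
    have "realify n n a *\<^sub>v v = 0\<^sub>v (2 * n)"
      unfolding eq[OF v] using u by (simp add: vu del: One_nat_def)
    then have "v = 0\<^sub>v (2 * n)"
      using \<open>det (realify n n a) \<noteq> 0\<close> v det_0_iff_vec_prod_zero_field[OF realify_carrier(1)] by blast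
    then show "u z = 0"
      using vu[OF z] z by (simp add: complex_eq_iff)
  next
    assume inj: "\<forall>u. (\<forall>x<n. (\<Sum>z<n. a x z * u z) = 0) \<longrightarrow> (\<forall>z<n. u z = 0)"
    show "det (realify n n a) \<noteq> 0"
    proof
      assume "det (realify n n a) = 0"
      then obtain v where v: "v \<in> carrier_vec (2 * n)" "v \<noteq> 0\<^sub>v (2 * n)"
        "realify n n a *\<^sub>v v = 0\<^sub>v (2 * n)"
        using det_0_iff_vec_prod_zero_field[OF realify_carrier(1)] by blast
      then have "\<forall>z<n. Complex (v $ (2 * z)) (- v $ (2 * z + 1)) = 0"
        using inj[rule_format, of "\<lambda>z. Complex (v $ (2 * z)) (- v $ (2 * z + 1))"]
        unfolding eq[OF v(1)] by blast
      then have "v $ i = 0" if "i < 2 * n" for i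
        using that by (elim less_double_cases) (simp_all add: complex_eq_iff)
      then show False using v(1,2) by (auto intro: eq_vecI)
    qed
  qed
qed

text \<open>A square matrix with trivial kernel has nonzero determinant, hence an inverse, which is
  applied to the right-hand side.\<close>

lemma injective_imp_solvable:
  fixes a :: "nat \<Rightarrow> nat \<Rightarrow> 'a::field"
  assumes "\<And>u z. (\<forall>x<n. (\<Sum>z<n. a x z * u z) = 0) \<Longrightarrow> z < n \<Longrightarrow> u z = 0"
  shows "\<exists>u. \<forall>x<n. (\<Sum>z<n. a x z * u z) = b x"
proof -
  define M where "M = mat n n (\<lambda>(x, z). a x z)"
  have M: "M \<in> carrier_mat n n" by (simp add: M_def)
  have M_mult: "(M *\<^sub>v v) $ x = (\<Sum>z<n. a x z * v $ z)" if "v \<in> carrier_vec n" "x < n" for v x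
    using that by (simp add: M_def scalar_prod_def atLeast0LessThan)
  have "det M \<noteq> 0"
  proof
    assume "det M = 0"
    then obtain v where v: "v \<in> carrier_vec n" "v \<noteq> 0\<^sub>v n" "M *\<^sub>v v = 0\<^sub>v n"
      using det_0_iff_vec_prod_zero_field[OF M] by blast
    have "(M *\<^sub>v v) $ x = 0" if "x < n" for x
      using v(3) that by simp
    then have "\<forall>x<n. (\<Sum>z<n. a x z * v $ z) = 0"
      using M_mult[OF v(1)] by metis
    then have "v $ z = 0" if "z < n" for z
      using assms[of "\<lambda>z. v $ z"] that by blast
    then show False using v(1,2) by (auto intro: eq_vecI)
  qed
  then obtain N where N: "N \<in> carrier_mat n n" "M * N = 1\<^sub>m n"
    using det_non_zero_imp_unit[OF M, of undefined]
    by (auto simp: Units_def ring_mat_def)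
  define v where "v = N *\<^sub>v vec n b"
  have v: "v \<in> carrier_vec n" using N(1) by (simp add: v_def)
  have "M *\<^sub>v v = vec n b"
    using N M by (simp add: v_def assoc_mult_mat_vec[symmetric, of _ n n _ n])
  then have "\<forall>x<n. (\<Sum>z<n. a x z * v $ z) = b x"
    using M_mult[OF v] by auto
  then show ?thesis by blast
qed

subsection \<open>The centralizer over the complex numbers\<close>

locale weyr_char =
  fixes m :: nat and w :: "nat \<Rightarrow> nat"
  assumes char: "noninc_pos_seq m w"
begin

lemma m_pos: "1 \<le> m"
  using char by (simp add: noninc_pos_seq_def)

lemma w_antimono: "1 \<le> i \<Longrightarrow> i \<le> j \<Longrightarrow> j \<le> m \<Longrightarrow> w j \<le> w i"
  using char by (auto simp: noninc_pos_seq_def monotone_on_def)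

lemma less_w_mono: "y < w j \<Longrightarrow> 1 \<le> i \<Longrightarrow> i \<le> j \<Longrightarrow> j \<le> m \<Longrightarrow> y < w i"
  using w_antimono[of i j] by simp

text \<open>For \<open>y\<close> = 0, 1, ... these are the parts of the partition conjugate to
  \<open>w\<close>, that is, the sizes of the corresponding Jordan blocks.\<close>

definition height :: "nat \<Rightarrow> nat" where
  "height y = card {i \<in> {1..m}. y < w i}"

lemma height_le: "height y \<le> m"
proof -
  have "height y \<le> card {1..m}"
    unfolding height_def by (rule card_mono) auto
  then show ?thesis by simp
qed

text \<open>As \<open>w\<close> is nonincreasing, the blocks that have a column \<open>y\<close>
  form an initial segment, of length \<open>height y\<close>.\<close>

lemma less_w_iff:
  assumes "t \<in> {1..m}"
  shows "y < w t \<longleftrightarrow> t \<le> height y"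
proof
  assume "y < w t"
  then have "{1..t} \<subseteq> {i \<in> {1..m}. y < w i}"
    using assms w_antimono[of _ t] by fastforce
  then show "t \<le> height y"
    using card_mono[of "{i \<in> {1..m}. y < w i}" "{1..t}"] by (simp add: height_def)
next
  assume t: "t \<le> height y"
  show "y < w t"
  proof (rule ccontr)
    assume "\<not> y < w t"
    then have "{i \<in> {1..m}. y < w i} \<subseteq> {1..<t}"
      using assms less_w_mono[of y _ t] by (fastforce simp: not_less[symmetric])
    then have "height y \<le> t - 1"
      using card_mono[of "{1..<t}" "{i \<in> {1..m}. y < w i}"] by (simp add: height_def)
    then show False using t assms by auto
  qed
qed

lemma height_antimono: "x \<le> y \<Longrightarrow> height y \<le> height x"
  unfolding height_def by (intro card_mono) auto

section \<open>Complex indices, and the structure of matrices commuting with the shift\<close>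

abbreviation pos :: "nat \<Rightarrow> nat \<Rightarrow> nat" where
  "pos i z \<equiv> offset w i + z"

abbreviation total :: nat where
  "total \<equiv> offset w (Suc m)"

lemma pos_one: "pos (Suc 0) z = z"
  by (simp add: offset_one)

text \<open>\<open>Y\<close> commutes with the nilpotent part of the complex Weyr matrix, written out entrywise.\<close>

definition commutes_shift :: "(nat \<Rightarrow> nat \<Rightarrow> complex) \<Rightarrow> bool" where
  "commutes_shift Y \<longleftrightarrow> (\<forall>i\<in>{1..m}. \<forall>j\<in>{1..m}. \<forall>x<w i. \<forall>y<w j.
     (if 1 < j then Y (pos i x) (pos (j - 1) y) else 0) =
     (if i < m \<and> x < w (i + 1) then Y (pos (i + 1) x) (pos j y) else 0))"

lemma commutes_shift_diff:
  assumes "commutes_shift Y" "commutes_shift Y'"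
  shows "commutes_shift (\<lambda>p q. Y p q - Y' p q)"
  unfolding commutes_shift_def
proof (intro ballI allI impI)
  fix i j x y assume *: "i \<in> {1..m}" "j \<in> {1..m}" "x < w i" "y < w j"
  note Y = assms[unfolded commutes_shift_def, rule_format, OF *]
  have "(if 1 < j then a - b else 0) = (if 1 < j then a else 0) - (if 1 < j then b else 0)"
    for a b :: complex by simp
  moreover have "(if i < m \<and> x < w (i + 1) then a - b else 0) =
      (if i < m \<and> x < w (i + 1) then a else 0) - (if i < m \<and> x < w (i + 1) then b else 0)"
    for a b :: complex by simp
  ultimately show "(if 1 < j then Y (pos i x) (pos (j - 1) y) - Y' (pos i x) (pos (j - 1) y) else 0) =
     (if i < m \<and> x < w (i + 1) then Y (pos (i + 1) x) (pos j y) - Y' (pos (i + 1) x) (pos j y) else 0)"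
    by (simp only: Y)
qed

text \<open>Each commutation equation moves an entry one block up and one block left. By induction
  the entry reaches the first block row, unless it runs out of block columns before and
  vanishes.\<close>

lemma commutes_shift_first_row:
  assumes Y: "commutes_shift Y"
    and "i \<in> {1..m}" "j \<in> {1..m}" "x < w i" "y < w j"
  shows "Y (pos i x) (pos j y) = (if i \<le> j then Y x (pos (j - i + 1) y) else 0)"
  using assms(2-)
proof (induction i arbitrary: j)
  case (Suc i)
  show ?case
  proof (cases "i = 0")
    case True
    then show ?thesis using Suc.prems by (simp add: pos_one)
  next
    case False
    have i: "i \<in> {1..m}" "x < w i"
      using False Suc.prems less_w_mono[of x "Suc i" i] by auto
    \<comment> \<open>The equation for block \<open>(i, j)\<close>; its right-hand side is present
      because \<open>x < w (Suc i)\<close>.\<close>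
    have "Y (pos (Suc i) x) (pos j y) = (if 1 < j then Y (pos i x) (pos (j - 1) y) else 0)"
      using Y[unfolded commutes_shift_def, rule_format, OF i(1) Suc.prems(2) i(2) Suc.prems(4)]
        Suc.prems by simp
    also have "\<dots> = (if Suc i \<le> j then Y x (pos (j - Suc i + 1) y) else 0)"
    proof (cases "1 < j")
      case True
      then have y: "y < w (j - 1)"
        using Suc.prems less_w_mono[of y j "j - 1"] by auto
      have "j - 1 \<in> {1..m}" using True Suc.prems(2) by auto
      moreover have "i \<le> j - 1 \<longleftrightarrow> Suc i \<le> j" "j - 1 - i + 1 = j - Suc i + 1"
        using True by auto
      ultimately show ?thesis
        using Suc.IH[OF i(1) _ i(2), of "j - 1"] y True by simp
    qed (use False Suc.prems in auto)
    finally show ?thesis .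
  qed
qed simp

text \<open>Block \<open>height x\<close> is the last one with a row \<open>x\<close>, so the
  equation for that row and block column \<open>height x + j\<close> has right-hand side 0. Its
  left-hand side is the entry in question, moved down its block diagonal.\<close>

lemma commutes_shift_support:
  assumes Y: "commutes_shift Y"
    and "j \<in> {1..m}" "x < w 1" "y < w j" "height x + j \<le> height y"
  shows "Y x (pos j y) = 0"
proof -
  let ?i = "height x"
  have i: "1 \<le> ?i" "?i < m"
    using assms m_pos less_w_iff[of 1 x] height_le[of y] by auto
  have x: "x < w ?i" "\<not> x < w (?i + 1)"
    using less_w_iff[of ?i x] less_w_iff[of "?i + 1" x] i by auto
  have y: "y < w (?i + j)"
    using less_w_iff[of "?i + j" y] assms i height_le[of y] by auto
  then have y': "y < w (?i + j - 1)"
    by (rule less_w_mono[of y "?i + j"]) (use assms i height_le[of y] in auto)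
  have mem: "?i \<in> {1..m}" "?i + j \<in> {1..m}" "?i + j - 1 \<in> {1..m}"
    using i assms height_le[of y] by auto
  have "Y (pos ?i x) (pos (?i + j - 1) y) = 0"
    using Y[unfolded commutes_shift_def, rule_format, OF mem(1,2) x(1) y] x(2) i assms by simp
  moreover have "?i \<le> ?i + j - 1" "?i + j - 1 - ?i + 1 = j"
    using assms by auto
  ultimately show ?thesis
    using commutes_shift_first_row[OF Y mem(1,3) x(1) y'] by simp
qed

text \<open>The first block row carries the unknowns, cut off where the support condition makes them
  vanish; a later block row \<open>i\<close> repeats entries of block column
  \<open>j - i + 1 < j\<close>. This makes prescribing the product a recursion on
  \<open>j\<close>.\<close>

lemma sum_commutes_shift:
  fixes a :: "nat \<Rightarrow> complex"
  assumes Y: "commutes_shift Y" and j: "j \<in> {1..m}" and y: "y < w j"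
  shows "(\<Sum>p<total. a p * Y p (pos j y)) =
    (\<Sum>z<w (height y + 1 - j). a z * Y z (pos j y)) +
    (\<Sum>i=2..j. \<Sum>z<w i. a (pos i z) * Y z (pos (j - i + 1) y))"
proof -
  let ?t = "height y + 1 - j"
  have hy: "j \<le> height y" using less_w_iff[OF j] y by simp
  have t: "?t \<in> {1..m}" using hy height_le[of y] j by auto
  have "(\<Sum>p<total. a p * Y p (pos j y)) =
      (\<Sum>i=1..m. \<Sum>z<w i. a (pos i z) * Y (pos i z) (pos j y))"
    by (rule sum_offset)
  also have "\<dots> = (\<Sum>i=1..m. if i \<le> j then \<Sum>z<w i. a (pos i z) * Y z (pos (j - i + 1) y) else 0)"
    using commutes_shift_first_row[OF Y _ j _ y] by (intro sum.cong) auto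
  also have "\<dots> = (\<Sum>i=1..j. \<Sum>z<w i. a (pos i z) * Y z (pos (j - i + 1) y))"
    using j by (intro sum.mono_neutral_cong_right) auto
  also have "\<dots> = (\<Sum>z<w 1. a z * Y z (pos j y)) +
      (\<Sum>i=2..j. \<Sum>z<w i. a (pos i z) * Y z (pos (j - i + 1) y))"
    using j by (subst sum.atLeast_Suc_atMost) (auto simp: pos_one numeral_2_eq_2)
  also have "(\<Sum>z<w 1. a z * Y z (pos j y)) = (\<Sum>z<w ?t. a z * Y z (pos j y))"
  proof (rule sum.mono_neutral_right)
    show "{..<w ?t} \<subseteq> {..<w 1}" using w_antimono[of 1 ?t] t by auto
    show "\<forall>z\<in>{..<w 1} - {..<w ?t}. a z * Y z (pos j y) = 0"
    proof
      fix z assume z: "z \<in> {..<w 1} - {..<w ?t}"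
      then have "height z + j \<le> height y"
        using less_w_iff[OF t, of z] hy by auto
      then show "a z * Y z (pos j y) = 0"
        using commutes_shift_support[OF Y j _ y, of z] z by simp
    qed
  qed simp
  finally show ?thesis .
qed

text \<open>Admissibility, for the complex entries \<open>a x p\<close> of the rows selected by the sequence of indices.\<close>

definition leading_injective :: "(nat \<Rightarrow> nat \<Rightarrow> complex) \<Rightarrow> bool" where
  "leading_injective a \<longleftrightarrow> (\<forall>t\<in>{1..m}. \<forall>u. (\<forall>x<w t. (\<Sum>z<w t. a x z * u z) = 0) \<longrightarrow>
     (\<forall>z<w t. u z = 0))"

section \<open>Uniqueness and existence for prescribed entries of the product\<close>

lemma commutes_shift_zero:
  assumes a: "leading_injective a" and Y: "commutes_shift Y"
    and zero: "\<And>x j y. x < w 1 \<Longrightarrow> j \<in> {1..m} \<Longrightarrow> y < w j \<Longrightarrow> height y < height x + j \<Longrightarrow>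
      (\<Sum>p<total. a x p * Y p (pos j y)) = 0"
    and pq: "p < total" "q < total"
  shows "Y p q = 0"
proof -
  \<comment> \<open>Strong induction on the block column: earlier columns vanish, which leaves a
    homogeneous system.\<close>
  have first: "Y z (pos j y) = 0" if "z < w 1" "j \<in> {1..m}" "y < w j" for z j y
    using that
  proof (induction j arbitrary: z y rule: less_induct)
    case (less j)
    let ?t = "height y + 1 - j"
    have hy: "j \<le> height y" using less_w_iff less.prems by simp
    have t: "?t \<in> {1..m}" using hy height_le[of y] less.prems by auto
    show ?case
    proof (cases "height y < height z + j")
      case True
      \<comment> \<open>Rows \<open>x < w ?t\<close> are exactly those where the product is
        prescribed, and columns \<open>z < w ?t\<close> exactly the unknowns not forced to be 0, so
        the system is square.\<close>
      have "(\<Sum>z<w ?t. a x z * Y z (pos j y)) = 0" if x: "x < w ?t" for x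
      proof -
        have "x < w 1" using x w_antimono[of 1 ?t] t by auto
        moreover have "height y < height x + j" using less_w_iff[OF t] x hy by auto
        ultimately have "(\<Sum>z<w ?t. a x z * Y z (pos j y)) +
          (\<Sum>i=2..j. \<Sum>z<w i. a x (pos i z) * Y z (pos (j - i + 1) y)) = 0"
          using zero[of x j y] sum_commutes_shift[OF Y less.prems(2,3)] less.prems by simp
        moreover have "Y z (pos (j - i + 1) y) = 0" if "i \<in> {2..j}" "z < w i" for i z
        proof (rule less.IH)
          show "z < w 1" by (rule less_w_mono[of z i]) (use that less.prems in auto)
          show "y < w (j - i + 1)" by (rule less_w_mono[of y j]) (use that less.prems in auto)
        qed (use that less.prems in auto)
        ultimately show ?thesis by simp
      qed
      moreover have "z < w ?t" using True less_w_iff[OF t] by auto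
      ultimately show ?thesis
        using a[unfolded leading_injective_def, rule_format, OF t, of "\<lambda>z. Y z (pos j y)"] by blast
    next
      case False
      then show ?thesis using commutes_shift_support[OF Y _ _ _] less.prems by simp
    qed
  qed
  obtain i x where p: "i \<in> {1..m}" "x < w i" "p = pos i x" using offset_cases[OF pq(1)] .
  obtain j y where q: "j \<in> {1..m}" "y < w j" "q = pos j y" using offset_cases[OF pq(2)] .
  show ?thesis
  proof (cases "i \<le> j")
    case True
    have "x < w 1" "y < w (j - i + 1)"
      using p q True less_w_mono[of x i 1] less_w_mono[of y j "j - i + 1"] by auto
    then show ?thesis
      using commutes_shift_first_row[OF Y p(1) q(1) p(2) q(2)] first[of x "j - i + 1" y] p q True
      by auto
  qed (use commutes_shift_first_row[OF Y p(1) q(1) p(2) q(2)] p q in auto)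
qed

text \<open>\<open>g j z y\<close> is to become the entry \<open>Y z (pos j y)\<close>. Block
  columns are found one after another, each column by solving a square system with an injective
  leading block.\<close>

lemma first_row_exists:
  assumes a: "leading_injective a"
  shows "\<exists>g :: nat \<Rightarrow> nat \<Rightarrow> nat \<Rightarrow> complex. \<forall>j\<in>{1..m}. \<forall>y<w j.
    (\<forall>z. height z + j \<le> height y \<longrightarrow> g j z y = 0) \<and>
    (\<forall>x<w 1. height y < height x + j \<longrightarrow>
      (\<Sum>z<w (height y + 1 - j). a x z * g j z y) +
      (\<Sum>i=2..j. \<Sum>z<w i. a x (pos i z) * g (j - i + 1) z y) = c x j y)"
proof -
  \<comment> \<open>\<open>S\<close> collects the contribution of the block columns before
    \<open>j\<close>, \<open>Q\<close> the demands on column \<open>(j, y)\<close>.\<close>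
  define S where "S f j y x = (\<Sum>i=2..j. \<Sum>z<w i. a x (pos i z) * f (j - i + 1) z y)"
    for f :: "nat \<Rightarrow> nat \<Rightarrow> nat \<Rightarrow> complex" and j y x :: nat
  define Q where "Q f j r y \<longleftrightarrow> (\<forall>z. height z + j \<le> height y \<longrightarrow> r z y = 0) \<and>
      (\<forall>x<w 1. height y < height x + j \<longrightarrow>
        (\<Sum>z<w (height y + 1 - j). a x z * r z y) + S f j y x = c x j y)"
    for f j and r :: "nat \<Rightarrow> nat \<Rightarrow> complex" and y
  have "\<exists>g. \<forall>j. j \<in> {1..m} \<longrightarrow> (\<forall>y<w j. Q g j (g j) y)"
  \<comment> \<open>Recursive choice along \<open><\<close>, legitimate because \<open>S f j\<close>
    evaluates \<open>f\<close> only at \<open>j - i + 1\<close> with \<open>i \<ge> 2\<close>, hence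
    below \<open>j\<close>.\<close>
  proof (rule dependent_wf_choice[where R = less_than and
        P = "\<lambda>f j r. j \<in> {1..m} \<longrightarrow> (\<forall>y<w j. Q f j r y)"])
    fix f g :: "nat \<Rightarrow> nat \<Rightarrow> nat \<Rightarrow> complex" and j r
    assume "\<And>z. (z, j) \<in> less_than \<Longrightarrow> f z = g z"
    then have "S f j y x = S g j y x" for y x
      unfolding S_def by (intro sum.cong) auto
    then show "(j \<in> {1..m} \<longrightarrow> (\<forall>y<w j. Q f j r y)) = (j \<in> {1..m} \<longrightarrow> (\<forall>y<w j. Q g j r y))"
      by (simp add: Q_def)
  next
    fix j f
    have "\<exists>v. (\<forall>z. height z + j \<le> height y \<longrightarrow> v z = 0) \<and>
      (\<forall>x<w 1. height y < height x + j \<longrightarrow>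
        (\<Sum>z<w (height y + 1 - j). a x z * v z) + S f j y x = c x j y)"
      if j: "j \<in> {1..m}" and y: "y < w j" for y
    proof -
      let ?t = "height y + 1 - j"
      have hy: "j \<le> height y" using less_w_iff[OF j] y by simp
      have t: "?t \<in> {1..m}" using hy height_le[of y] j by auto
      obtain u where u: "\<forall>x<w ?t. (\<Sum>z<w ?t. a x z * u z) = c x j y - S f j y x"
        using injective_imp_solvable[of "w ?t" a "\<lambda>x. c x j y - S f j y x"]
          a[unfolded leading_injective_def, rule_format, OF t] by blast
      \<comment> \<open>The solution is extended by 0 from \<open>w ?t\<close> on, exactly where the
        support condition demands it.\<close>
      show ?thesis
        using u less_w_iff[OF t] hy
        by (intro exI[of _ "\<lambda>z. if z < w ?t then u z else 0"]) auto
    qed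
    then have "\<forall>y. \<exists>v. j \<in> {1..m} \<longrightarrow> y < w j \<longrightarrow>
      (\<forall>z. height z + j \<le> height y \<longrightarrow> v z = 0) \<and>
      (\<forall>x<w 1. height y < height x + j \<longrightarrow>
        (\<Sum>z<w (height y + 1 - j). a x z * v z) + S f j y x = c x j y)" by blast
    then obtain v where v: "\<forall>y. j \<in> {1..m} \<longrightarrow> y < w j \<longrightarrow>
      (\<forall>z. height z + j \<le> height y \<longrightarrow> v y z = 0) \<and>
      (\<forall>x<w 1. height y < height x + j \<longrightarrow>
        (\<Sum>z<w (height y + 1 - j). a x z * v y z) + S f j y x = c x j y)"
      by (rule choice[THEN exE])
    show "\<exists>r. j \<in> {1..m} \<longrightarrow> (\<forall>y<w j. Q f j r y)"
    proof (intro exI[of _ "\<lambda>z y. v y z"] impI allI)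
      fix y assume "j \<in> {1..m}" "y < w j"
      with v show "Q f j (\<lambda>z y. v y z) y" unfolding Q_def by blast
    qed
  qed simp
  then show ?thesis unfolding Q_def S_def by blast
qed

text \<open>The first block row given by \<open>g\<close> is continued along the block diagonals.
  Commutation could fail only at the last block that has a given row, and there the support
  condition applies.\<close>

lemma commutes_shift_exists:
  assumes a: "leading_injective a"
  shows "\<exists>Y. commutes_shift Y \<and>
    (\<forall>x<w 1. \<forall>j\<in>{1..m}. \<forall>y<w j. height y < height x + j \<longrightarrow>
      (\<Sum>p<total. a x p * Y p (pos j y)) = c x j y)"
proof -
  obtain g :: "nat \<Rightarrow> nat \<Rightarrow> nat \<Rightarrow> complex"
    where supp: "\<And>j y z. j \<in> {1..m} \<Longrightarrow> y < w j \<Longrightarrow> height z + j \<le> height y \<Longrightarrow> g j z y = 0"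
      and sol: "\<And>j y x. j \<in> {1..m} \<Longrightarrow> y < w j \<Longrightarrow> x < w 1 \<Longrightarrow> height y < height x + j \<Longrightarrow>
        (\<Sum>z<w (height y + 1 - j). a x z * g j z y) +
        (\<Sum>i=2..j. \<Sum>z<w i. a x (pos i z) * g (j - i + 1) z y) = c x j y"
    using first_row_exists[OF a, of c] by blast
  define Y where "Y p q = (let i = block_of w p; j = block_of w q in
    if i \<le> j then g (j - i + 1) (p - offset w i) (q - offset w j) else 0)" for p q
  have Y_pos: "Y (pos i x) (pos j y) = (if i \<le> j then g (j - i + 1) x y else 0)"
    if "i \<in> {1..m}" "j \<in> {1..m}" "x < w i" "y < w j" for i j x y
    using that by (simp add: Y_def block_of_eq)
  have Y_first: "Y x (pos j y) = g j x y" if "x < w 1" "j \<in> {1..m}" "y < w j" for x j y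
    using Y_pos[of 1 j x y] that m_pos by (simp add: pos_one)
  have Y: "commutes_shift Y"
    unfolding commutes_shift_def
  proof (intro ballI allI impI)
    fix i j x y assume *: "i \<in> {1..m}" "j \<in> {1..m}" "x < w i" "y < w j"
    show "(if 1 < j then Y (pos i x) (pos (j - 1) y) else 0) =
     (if i < m \<and> x < w (i + 1) then Y (pos (i + 1) x) (pos j y) else 0)"
    proof (cases "1 < j")
      case True
      then have j: "j - 1 \<in> {1..m}" "y < w (j - 1)"
        using * less_w_mono[of y j "j - 1"] by auto
      have "(if i < j then g (j - i) x y else 0) =
          (if i < m \<and> x < w (i + 1) \<and> i < j then g (j - i) x y else 0)"
      \<comment> \<open>The sides can differ only for a row \<open>x\<close> that ends in block
        \<open>i\<close>; then \<open>height x = i\<close>, and the support condition gives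
        \<open>g (j - i) x y = 0\<close>.\<close>
      proof (cases "i < j \<and> \<not> x < w (i + 1)")
        case True
        then have "height x = i"
          using less_w_iff[of i x] less_w_iff[of "i + 1" x] * by auto
        have "g (j - i) x y = 0"
        proof (intro supp)
          show "j - i \<in> {1..m}" using True * by auto
          then show "y < w (j - i)" using less_w_mono[of y j "j - i"] * by auto
          show "height x + (j - i) \<le> height y"
            using \<open>height x = i\<close> True less_w_iff[OF *(2), of y] * by auto
        qed
        then show ?thesis by simp
      qed (use * in auto)
      then show ?thesis
        using Y_pos[OF *(1) j(1) *(3) j(2)] Y_pos[of "i + 1" j x y] * True
        by (auto simp: Suc_diff_Suc split: if_splits)
    qed (use Y_pos[of "i + 1" j x y] * in auto)
  qed
  have "(\<Sum>p<total. a x p * Y p (pos j y)) = c x j y"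
    if *: "x < w 1" "j \<in> {1..m}" "y < w j" "height y < height x + j" for x j y
  proof -
    let ?t = "height y + 1 - j"
    have hy: "j \<le> height y" using less_w_iff * by simp
    have t: "?t \<in> {1..m}" using hy height_le[of y] * by auto
    have "(\<Sum>z<w ?t. a x z * Y z (pos j y)) = (\<Sum>z<w ?t. a x z * g j z y)"
      using w_antimono[of 1 ?t] t * by (intro sum.cong) (auto simp: Y_first)
    moreover have "(\<Sum>i=2..j. \<Sum>z<w i. a x (pos i z) * Y z (pos (j - i + 1) y)) =
        (\<Sum>i=2..j. \<Sum>z<w i. a x (pos i z) * g (j - i + 1) z y)"
    proof (intro sum.cong refl)
      fix i z assume "i \<in> {2..j}" "z \<in> {..<w i}"
      then have "z < w 1" "j - i + 1 \<in> {1..m}" "y < w (j - i + 1)"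
        using * less_w_mono[of z i 1] less_w_mono[of y j "j - i + 1"] by auto
      then show "a x (pos i z) * Y z (pos (j - i + 1) y) = a x (pos i z) * g (j - i + 1) z y"
        by (simp add: Y_first)
    qed
    ultimately show ?thesis
      using sum_commutes_shift[OF Y *(2,3), of "a x"] sol[OF *(2,3,1,4)] by simp
  qed
  with Y show ?thesis by blast
qed

text \<open>\<open>Y\<close> is block upper triangular, and its diagonal blocks are nonsingular because \<open>L\<close> below, the
  product of leading blocks of \<open>a\<close> and \<open>Y\<close>, is lower unitriangular.\<close>

lemma commutes_shift_injective:
  assumes Y: "commutes_shift Y"
    and norm: "\<And>x j y. x < w 1 \<Longrightarrow> j \<in> {1..m} \<Longrightarrow> y < w j \<Longrightarrow> height y < height x + j \<Longrightarrow>
      (\<Sum>p<total. a x p * Y p (pos j y)) = (if j = 1 \<and> x = y then 1 else 0)"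
    and ker: "\<And>p. p < total \<Longrightarrow> (\<Sum>q<total. Y p q * u q) = 0"
    and q: "q < total"
  shows "u q = 0"
proof -
  have "u (pos i y) = 0" if "i \<in> {1..m}" "y < w i" for i y
    using that
  \<comment> \<open>The block upper triangular shape allows back substitution from the last block of
    \<open>u\<close> to the first.\<close>
  proof (induction "m - i" arbitrary: i y rule: less_induct)
    case less
    note i = less.prems(1)
    define L where "L x y = (\<Sum>z<w i. a x z * Y z y)" for x y
    have iw: "w i \<le> w 1" using w_antimono[of 1 i] i by simp
    \<comment> \<open>For \<open>x \<le> y\<close> the height of \<open>x\<close> is at least that
      of \<open>y\<close>, so the product is prescribed at this entry. As
      \<open>i \<le> height y\<close>, enlarging the sum from \<open>w (height y)\<close> to
      \<open>w i\<close> adds only zeros.\<close>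
    have L: "L x y = (if x = y then 1 else 0)" if "x < w i" "y < w i" "x \<le> y" for x y
    proof -
      have h: "i \<le> height y" "1 \<le> height y" "height y \<in> {1..m}"
        using that less_w_iff[of i y] i height_le[of y] by auto
      have "(\<Sum>p<total. a x p * Y p (pos 1 y)) = (\<Sum>z<w (height y). a x z * Y z y)"
        using sum_commutes_shift[OF Y, of 1 y "a x"] m_pos that iw by (simp add: pos_one)
      also have "\<dots> = L x y"
        unfolding L_def
      proof (rule sum.mono_neutral_left)
        show "{..<w (height y)} \<subseteq> {..<w i}" using w_antimono[of i "height y"] h i by auto
        show "\<forall>z\<in>{..<w i} - {..<w (height y)}. a x z * Y z y = 0"
        proof
          fix z assume z: "z \<in> {..<w i} - {..<w (height y)}"
          then have "height z + 1 \<le> height y"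
            using less_w_iff[OF h(3), of z] by auto
          then show "a x z * Y z y = 0"
            using commutes_shift_support[OF Y, of 1 z y] z m_pos that iw by (simp add: pos_one)
        qed
      qed simp
      finally show ?thesis
        using norm[of x 1 y] that iw m_pos height_antimono[OF that(3)] by simp
    qed
    \<comment> \<open>Blocks left of the diagonal vanish, those right of it meet components of
      \<open>u\<close> already known to be 0, and the diagonal block repeats the first one.\<close>
    have row: "(\<Sum>y<w i. Y z y * u (pos i y)) = 0" if z: "z < w i" for z
    proof -
      have "0 = (\<Sum>j=1..m. \<Sum>y<w j. Y (pos i z) (pos j y) * u (pos j y))"
        using ker[OF offset_add_less[of i m z w, OF i z]] by (simp only: sum_offset)
      also have "\<dots> = (\<Sum>j=1..m. if j = i then \<Sum>y<w i. Y z y * u (pos i y) else 0)"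
      proof (intro sum.cong refl)
        fix j assume j: "j \<in> {1..m}"
        consider "j < i" | "j = i" | "i < j" by linarith
        then show "(\<Sum>y<w j. Y (pos i z) (pos j y) * u (pos j y)) =
            (if j = i then \<Sum>y<w i. Y z y * u (pos i y) else 0)"
        proof cases
          case 3
          then show ?thesis using less.hyps[of j] j by auto
        qed (use commutes_shift_first_row[OF Y i j z] in \<open>auto simp: pos_one\<close>)
      qed
      also have "\<dots> = (\<Sum>y<w i. Y z y * u (pos i y))" using i by simp
      finally show ?thesis by simp
    qed
    have L_row: "(\<Sum>y<w i. L x y * u (pos i y)) = 0" for x
    proof -
      have "(\<Sum>y<w i. L x y * u (pos i y)) = (\<Sum>y<w i. \<Sum>z<w i. a x z * (Y z y * u (pos i y)))"
        by (simp add: L_def sum_distrib_right mult.assoc)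
      also have "\<dots> = (\<Sum>z<w i. a x z * (\<Sum>y<w i. Y z y * u (pos i y)))"
        by (subst sum.swap) (simp add: sum_distrib_left)
      also have "\<dots> = 0" using row by simp
      finally show ?thesis .
    qed
    \<comment> \<open>Forward substitution with \<open>L\<close>: its entries for
      \<open>y < x\<close> are unknown but meet zeros.\<close>
    have "x < w i \<Longrightarrow> u (pos i x) = 0" for x
    proof (induction x rule: less_induct)
      case (less x)
      have "L x y * u (pos i y) = (if y = x then u (pos i x) else 0)" if "y < w i" for y
        using less L[OF less.prems that] that by (cases y x rule: linorder_cases) (auto simp: L)
      then have "(\<Sum>y<w i. L x y * u (pos i y)) = (\<Sum>y<w i. if y = x then u (pos i x) else 0)"
        by (intro sum.cong) auto
      then show ?case using L_row[of x] less.prems by simp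
    qed
    then show ?case using less.prems(2) .
  qed
  then show ?thesis using offset_cases[OF q] by metis
qed

end

subsection \<open>Commutation with the real Weyr matrix\<close>

lemma invertible_mat_iff_det:
  fixes A :: "'a::field mat"
  assumes A: "A \<in> carrier_mat n n"
  shows "invertible_mat A \<longleftrightarrow> det A \<noteq> 0"
proof
  assume "invertible_mat A"
  then obtain B where "A * B = 1\<^sub>m n" "B * A = 1\<^sub>m (dim_row B)"
    using A by (auto simp: invertible_mat_def inverts_mat_def)
  then have B: "B \<in> carrier_mat n n" "A * B = 1\<^sub>m n"
    using A by (metis carrier_matD(2) carrier_matI index_mult_mat(3) index_one_mat(3))+
  then have "det A * det B = 1"
    using det_mult[OF A B(1)] by simp
  then show "det A \<noteq> 0" by auto
next
  assume "det A \<noteq> 0"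
  then obtain B where "B \<in> carrier_mat n n" "A * B = 1\<^sub>m n" "B * A = 1\<^sub>m n"
    using det_non_zero_imp_unit[OF A, of undefined] by (auto simp: Units_def ring_mat_def)
  then show "invertible_mat A"
    using A by (auto simp: invertible_mat_def inverts_mat_def)
qed

text \<open>An invertible \<open>X\<close> permutes the coefficient vectors, so the column space
  does not change.\<close>

lemma (in vec_space) rank_mult_invertible:
  assumes A: "A \<in> carrier_mat n c" and X: "X \<in> carrier_mat c c" and inv: "det X \<noteq> 0"
  shows "rank (A * X) = rank A"
proof -
  obtain Z where Z: "Z \<in> carrier_mat c c" "X * Z = 1\<^sub>m c"
    using det_non_zero_imp_unit[OF X inv, of undefined] by (auto simp: Units_def ring_mat_def)
  have "(\<exists>u\<in>carrier_vec c. A * X *\<^sub>v u = y) \<longleftrightarrow> (\<exists>u\<in>carrier_vec c. A *\<^sub>v u = y)" for y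
  proof
    assume "\<exists>u\<in>carrier_vec c. A * X *\<^sub>v u = y"
    then obtain u where "u \<in> carrier_vec c" "A * X *\<^sub>v u = y" by blast
    then show "\<exists>u\<in>carrier_vec c. A *\<^sub>v u = y"
      using A X by (intro bexI[of _ "X *\<^sub>v u"]) auto
  next
    assume "\<exists>u\<in>carrier_vec c. A *\<^sub>v u = y"
    then obtain u where u: "u \<in> carrier_vec c" "A *\<^sub>v u = y" by blast
    have "A * X *\<^sub>v (Z *\<^sub>v u) = A *\<^sub>v (X *\<^sub>v (Z *\<^sub>v u))"
      using A X Z(1) u(1) by (intro assoc_mult_mat_vec) auto
    also have "X *\<^sub>v (Z *\<^sub>v u) = (X * Z) *\<^sub>v u"
      using X Z(1) u(1) by (intro assoc_mult_mat_vec[symmetric]) auto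
    finally have "A * X *\<^sub>v (Z *\<^sub>v u) = y" using Z(2) u by simp
    then show "\<exists>u\<in>carrier_vec c. A * X *\<^sub>v u = y"
      using Z(1) u(1) by (intro bexI[of _ "Z *\<^sub>v u"]) auto
  qed
  then have "col_space (A * X) = col_space A"
    using col_space_eq[OF A] col_space_eq[of "A * X" c] A X by simp
  then show ?thesis
    by (simp add: rank_def col_space_def)
qed

lemma submat_all_cols_mult:
  fixes A :: "'a::semiring_0 mat"
  assumes "A \<in> carrier_mat n c" "X \<in> carrier_mat c q" "set I \<subseteq> {..<n}"
  shows "submat A I [0..<c] * X = submat (A * X) I [0..<q]"
proof (rule eq_matI)
  fix i j assume "i < dim_row (submat (A * X) I [0..<q])" "j < dim_col (submat (A * X) I [0..<q])"
  then have ij: "i < length I" "j < q" by (auto simp: submat_def)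
  then have "I ! i < n" using assms(3) by (auto simp: subset_iff)
  then show "(submat A I [0..<c] * X) $$ (i, j) = submat (A * X) I [0..<q] $$ (i, j)"
    using ij assms by (simp add: submat_def scalar_prod_def)
qed (use assms in \<open>auto simp: submat_def\<close>)

lemma pow_mat_commute:
  fixes X :: "'a::semiring_1 mat"
  assumes X: "X \<in> carrier_mat n n" and W: "W \<in> carrier_mat n n" and c: "X * W = W * X"
  shows "X * W ^\<^sub>m l = W ^\<^sub>m l * X"
proof (induction l)
  case (Suc l)
  have Wl: "W ^\<^sub>m l \<in> carrier_mat n n" using W by simp
  have "X * W ^\<^sub>m Suc l = X * W ^\<^sub>m l * W"
    using assoc_mult_mat[OF X Wl W] by simp
  also have "\<dots> = W ^\<^sub>m l * (X * W)"
    using Suc assoc_mult_mat[OF Wl X W] by simp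
  also have "\<dots> = W ^\<^sub>m Suc l * X"
    using c assoc_mult_mat[OF Wl W X] by simp
  finally show ?case .
qed (use X W in simp)

lemma set_block_range: "i \<in> {1..k} \<Longrightarrow> set (block_range r i) \<subseteq> {..<offset r (Suc k)}"
  using offset_mono[of "Suc i" "Suc k" r] by (auto simp: block_range_def)

text \<open>\<open>X\<close> commutes with the powers of \<open>W\<close>, and right multiplication
  commutes with selecting rows, so the relation between the row blocks survives; invertibility keeps
  the rank.\<close>

lemma obs_mats_mult:
  assumes r: "noninc_pos_seq k r" and P: "P \<in> obs_mats W k r" and W: "W \<in> carrier_mat c c"
    and X: "X \<in> centralizer_group W"
  shows "P * X \<in> obs_mats W k r"
proof -
  let ?n = "\<Sum>i = 1..k. r i"
  have n: "?n = offset r (Suc k)"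
    by (simp add: offset_def atLeastLessThanSuc_atLeastAtMost)
  have k: "1 \<le> k" using r by (simp add: noninc_pos_seq_def)
  have Xc: "X \<in> carrier_mat c c" and comm: "X * W = W * X" and det: "det X \<noteq> 0"
    using X W invertible_mat_iff_det[of X c] by (auto simp: centralizer_group_def)
  have Pc: "P \<in> carrier_mat ?n c"
    using P W by (simp only: obs_mats_def mem_Collect_eq carrier_matD)
  then have "dim_row P = ?n" by simp
  then have rank: "vec_space.rank ?n P = c"
    and blocks: "\<And>i. i \<in> {1..k} \<Longrightarrow> row_block r P i =
      submat (row_block r P 1 * W ^\<^sub>m (i - 1)) [0..<r i] [0..<c]"
    using P W by (simp_all only: obs_mats_def mem_Collect_eq carrier_matD)
  have row: "row_block r (P * X) i = row_block r P i * X" if "i \<in> {1..k}" for i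
  proof -
    have "dim_col P = c" "dim_col (P * X) = c" using Pc Xc by simp_all
    moreover have "set (block_range r i) \<subseteq> {..<?n}" unfolding n by (rule set_block_range[OF that])
    ultimately show ?thesis
      unfolding row_block_def using submat_all_cols_mult[OF Pc Xc] by metis
  qed
  have "row_block r (P * X) i = submat (row_block r (P * X) 1 * W ^\<^sub>m (i - 1)) [0..<r i] [0..<c]"
    if i: "i \<in> {1..k}" for i
  proof -
    let ?P1 = "row_block r P 1" and ?Wi = "W ^\<^sub>m (i - 1)"
    have P1: "?P1 \<in> carrier_mat (r 1) c"
      using Pc by (auto simp: row_block_def submat_def block_range_def offset_Suc)
    have Wi: "?Wi \<in> carrier_mat c c" using W by simp
    have ri: "r i \<le> r 1" using r i k by (auto simp: noninc_pos_seq_def monotone_on_def)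
    have "row_block r (P * X) i = submat (?P1 * ?Wi) [0..<r i] [0..<c] * X"
      using row[OF i] blocks[OF i] by simp
    also have "\<dots> = submat (?P1 * ?Wi * X) [0..<r i] [0..<c]"
      using P1 Wi Xc ri by (intro submat_all_cols_mult[of _ "r 1"]) auto
    also have "?P1 * ?Wi * X = ?P1 * X * ?Wi"
      using assoc_mult_mat[OF P1 Wi Xc] assoc_mult_mat[OF P1 Xc Wi] pow_mat_commute[OF Xc W comm]
      by simp
    also have "?P1 * X = row_block r (P * X) 1"
      using row[of 1] k by simp
    finally show ?thesis .
  qed
  moreover have "vec_space.rank ?n (P * X) = c"
    using vec_space.rank_mult_invertible[OF Pc Xc det] rank by simp
  moreover have "P * X \<in> carrier_mat ?n c" "dim_row (P * X) = ?n" "dim_col W = c"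
    using Pc Xc W by simp_all
  ultimately show ?thesis
    unfolding obs_mats_def mem_Collect_eq by metis
qed

context weyr_char
begin

section \<open>Products with the real Weyr matrix, cell by cell\<close>

lemma less_w_pred:
  assumes "1 < j" "j \<in> {1..m}" "y < w j"
  shows "j - 1 \<in> {1..m}" "y < w (j - 1)"
proof -
  show "j - 1 \<in> {1..m}" using assms(1,2) by auto
  show "y < w (j - 1)" by (rule less_w_mono[OF assms(3)]) (use assms(1,2) in auto)
qed

lemma real_weyr_carrier: "real_weyr \<mu> m w \<in> carrier_mat (2 * total) (2 * total)"
  by (simp add: real_weyr_def of_blocks_def offset_double)

text \<open>Writing a real index as \<open>2 * pos i x + e\<close> separates the complex index from
  the position \<open>e\<close> in its cell. The diagonal blocks repeat the eigenvalue cell; the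
  superdiagonal ones form a shift with identity cells.\<close>

lemma real_weyr_index:
  assumes "i \<in> {1..m}" "j \<in> {1..m}" "x < w i" "y < w j" "e < 2" "f < 2"
  shows "real_weyr \<mu> m w $$ (2 * pos i x + e, 2 * pos j y + f) =
    (if x = y then if j = i then cell (Re \<mu>) (Im \<mu>) $$ (e, f)
       else if j = i + 1 \<and> e = f then 1 else 0 else 0)"
proof -
  let ?n = "\<lambda>i. 2 * w i"
  have eq: "2 * pos i x + e = offset ?n i + (2 * x + e)" "2 * pos j y + f = offset ?n j + (2 * y + f)"
    by (simp_all only: offset_double add_mult_distrib2 add.assoc)
  have less: "2 * x + e < 2 * w i" "2 * y + f < 2 * w j" using assms by auto
  have div: "(2 * x + e) div 2 = x" "(2 * x + e) mod 2 = e"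
    "(2 * y + f) div 2 = y" "(2 * y + f) mod 2 = f" using assms by auto
  have "real_weyr \<mu> m w $$ (2 * pos i x + e, 2 * pos j y + f) =
    (if j = i then copies (w i) (cell (Re \<mu>) (Im \<mu>)) $$ (2 * x + e, 2 * y + f)
     else if j = i + 1 then tall_id (2 * w i) (2 * w j) $$ (2 * x + e, 2 * y + f) else 0)"
    unfolding eq real_weyr_def of_blocks_def
    using assms less offset_add_less[of i m "2 * x + e" ?n] offset_add_less[of j m "2 * y + f" ?n]
    by (simp add: block_of_eq)
  also have "\<dots> = (if x = y then if j = i then cell (Re \<mu>) (Im \<mu>) $$ (e, f)
       else if j = i + 1 \<and> e = f then 1 else 0 else 0)"
  proof -
    consider "j = i" | "j = i + 1" | "j \<noteq> i" "j \<noteq> i + 1" by blast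
    then show ?thesis
    proof cases
      case 1
      then show ?thesis using less copies_index[OF cell_carrier, of "2 * x + e" "w i" "2 * y + f"] div by simp
    next
      case 2
      have "2 * x + e = 2 * y + f \<longleftrightarrow> x = y \<and> e = f" using div by metis
      then show ?thesis using 2 less w_antimono[of i "i + 1"] assms
        tall_id_index[of "2 * w j" "2 * w i" "2 * x + e" "2 * y + f"] by auto
    qed auto
  qed
  finally show ?thesis .
qed

lemma sum_double_total:
  fixes f :: "nat \<Rightarrow> 'a::comm_monoid_add"
  shows "sum f {..<2 * total} = (\<Sum>i=1..m. \<Sum>z<w i. f (2 * pos i z) + f (2 * pos i z + 1))"
  by (simp only: sum_lessThan_double sum_offset)

lemma sum_block_delta:
  fixes c :: "'a::comm_monoid_add"
  assumes "j \<in> {1..m}" "y < w j"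
  shows "(\<Sum>i=1..m. \<Sum>z<w i. if i = j \<and> z = y then c else 0) = c"
proof -
  have "(\<Sum>i=1..m. \<Sum>z<w i. if i = j \<and> z = y then c else 0) = (\<Sum>i=1..m. if i = j then c else 0)"
    using assms by (intro sum.cong refl) auto
  then show ?thesis using assms by simp
qed

lemma mult_real_weyr_index:
  assumes A: "A \<in> carrier_mat n (2 * total)" "r < n" and j: "j \<in> {1..m}" "y < w j" "f < 2"
  shows "(A * real_weyr \<mu> m w) $$ (r, 2 * pos j y + f) =
    A $$ (r, 2 * pos j y) * cell (Re \<mu>) (Im \<mu>) $$ (0, f) +
    A $$ (r, 2 * pos j y + 1) * cell (Re \<mu>) (Im \<mu>) $$ (1, f) +
    (if 1 < j then A $$ (r, 2 * pos (j - 1) y + f) else 0)"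
proof -
  let ?W = "real_weyr \<mu> m w" and ?B = "cell (Re \<mu>) (Im \<mu>)" and ?c = "2 * pos j y + f"
  let ?d = "A $$ (r, 2 * pos j y) * ?B $$ (0, f) + A $$ (r, 2 * pos j y + 1) * ?B $$ (1, f)"
  let ?s = "if 1 < j then A $$ (r, 2 * pos (j - 1) y + f) else 0"
  have c: "?c < 2 * total" using offset_add_less[of j m y w] j by auto
  have "(A * ?W) $$ (r, ?c) = (\<Sum>l<2 * total. A $$ (r, l) * ?W $$ (l, ?c))"
    using A c real_weyr_carrier[of \<mu>] by (simp add: scalar_prod_def atLeast0LessThan)
  \<comment> \<open>This column meets only its diagonal cell and the identity cell one block above.
    For \<open>j = 1\<close> there is no such block, and \<open>?s\<close> is 0.\<close>
  also have "\<dots> = (\<Sum>i=1..m. \<Sum>z<w i. (if i = j \<and> z = y then ?d else 0) +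
      (if i = j - 1 \<and> z = y then ?s else 0))"
    unfolding sum_double_total
  proof (intro sum.cong refl)
    fix i z assume iz: "i \<in> {1..m}" "z \<in> {..<w i}"
    have f: "f = 0 \<or> f = 1" using j by auto
    from iz j show "A $$ (r, 2 * pos i z) * ?W $$ (2 * pos i z, ?c) +
        A $$ (r, 2 * pos i z + 1) * ?W $$ (2 * pos i z + 1, ?c) =
        (if i = j \<and> z = y then ?d else 0) + (if i = j - 1 \<and> z = y then ?s else 0)"
      using real_weyr_index[of i j z y 0 f \<mu>] real_weyr_index[of i j z y 1 f \<mu>] f
      by auto
  qed
  also have "\<dots> = ?d + ?s"
  proof -
    have "(\<Sum>i=1..m. \<Sum>z<w i. if i = j - 1 \<and> z = y then ?s else 0) = ?s"
    proof (cases "1 < j")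
      case True
      then have "j - 1 \<in> {1..m}" "y < w (j - 1)"
        using j less_w_pred by auto
      then show ?thesis by (rule sum_block_delta)
    qed simp
    then show ?thesis
      by (simp only: sum.distrib sum_block_delta[OF j(1,2)])
  qed
  finally show ?thesis .
qed

lemma real_weyr_mult_index:
  assumes A: "A \<in> carrier_mat (2 * total) n" "c < n" and i: "i \<in> {1..m}" "x < w i" "e < 2"
  shows "(real_weyr \<mu> m w * A) $$ (2 * pos i x + e, c) =
    cell (Re \<mu>) (Im \<mu>) $$ (e, 0) * A $$ (2 * pos i x, c) +
    cell (Re \<mu>) (Im \<mu>) $$ (e, 1) * A $$ (2 * pos i x + 1, c) +
    (if i < m \<and> x < w (i + 1) then A $$ (2 * pos (i + 1) x + e, c) else 0)"
proof -
  let ?W = "real_weyr \<mu> m w" and ?B = "cell (Re \<mu>) (Im \<mu>)" and ?r = "2 * pos i x + e"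
  let ?d = "?B $$ (e, 0) * A $$ (2 * pos i x, c) + ?B $$ (e, 1) * A $$ (2 * pos i x + 1, c)"
  let ?s = "if i < m \<and> x < w (i + 1) then A $$ (2 * pos (i + 1) x + e, c) else 0"
  have r: "?r < 2 * total" using offset_add_less[of i m x w] i by auto
  have "(?W * A) $$ (?r, c) = (\<Sum>l<2 * total. ?W $$ (?r, l) * A $$ (l, c))"
    using A r real_weyr_carrier[of \<mu>] by (simp add: scalar_prod_def atLeast0LessThan)
  \<comment> \<open>Dually, this row meets its diagonal cell and an identity cell in block
    \<open>i + 1\<close>, present only if that block has a column \<open>x\<close>.\<close>
  also have "\<dots> = (\<Sum>j=1..m. \<Sum>z<w j. (if j = i \<and> z = x then ?d else 0) +
      (if j = i + 1 \<and> z = x then ?s else 0))"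
    unfolding sum_double_total
  proof (intro sum.cong refl)
    fix j z assume jz: "j \<in> {1..m}" "z \<in> {..<w j}"
    have e: "e = 0 \<or> e = 1" using i by auto
    from jz i show "?W $$ (?r, 2 * pos j z) * A $$ (2 * pos j z, c) +
        ?W $$ (?r, 2 * pos j z + 1) * A $$ (2 * pos j z + 1, c) =
        (if j = i \<and> z = x then ?d else 0) + (if j = i + 1 \<and> z = x then ?s else 0)"
      using real_weyr_index[of i j x z e 0 \<mu>] real_weyr_index[of i j x z e 1 \<mu>] e
      by auto
  qed
  also have "\<dots> = ?d + ?s"
  proof -
    have "(\<Sum>j=1..m. \<Sum>z<w j. if j = i + 1 \<and> z = x then ?s else 0) = ?s"
    proof (cases "i < m \<and> x < w (i + 1)")
      case True
      then have "i + 1 \<in> {1..m}" "x < w (i + 1)" by auto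
      then show ?thesis by (rule sum_block_delta)
    qed auto
    then show ?thesis
      by (simp only: sum.distrib sum_block_delta[OF i(1,2)])
  qed
  finally show ?thesis .
qed

lemma commute_real_weyr_entry:
  assumes X: "X \<in> carrier_mat (2 * total) (2 * total)"
    and i: "i \<in> {1..m}" "x < w i" "e < 2" and j: "j \<in> {1..m}" "y < w j" "f < 2"
  shows "(X * real_weyr \<mu> m w) $$ (2 * pos i x + e, 2 * pos j y + f) =
      (real_weyr \<mu> m w * X) $$ (2 * pos i x + e, 2 * pos j y + f) \<longleftrightarrow>
    X $$ (2 * pos i x + e, 2 * pos j y) * cell (Re \<mu>) (Im \<mu>) $$ (0, f) +
    X $$ (2 * pos i x + e, 2 * pos j y + 1) * cell (Re \<mu>) (Im \<mu>) $$ (1, f) +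
    (if 1 < j then X $$ (2 * pos i x + e, 2 * pos (j - 1) y + f) else 0) =
    cell (Re \<mu>) (Im \<mu>) $$ (e, 0) * X $$ (2 * pos i x, 2 * pos j y + f) +
    cell (Re \<mu>) (Im \<mu>) $$ (e, 1) * X $$ (2 * pos i x + 1, 2 * pos j y + f) +
    (if i < m \<and> x < w (i + 1) then X $$ (2 * pos (i + 1) x + e, 2 * pos j y + f) else 0)"
proof -
  have "2 * pos i x + e < 2 * total" "2 * pos j y + f < 2 * total"
    using offset_add_less[of i m x w] offset_add_less[of j m y w] i j by auto
  then show ?thesis
    by (simp only: mult_real_weyr_index[OF X _ j] real_weyr_mult_index[OF X _ i])
qed

text \<open>All cells commute with the eigenvalue cell, so those terms cancel; the two remaining
  shifted terms agree by \<open>commutes_shift\<close>.\<close>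

lemma commutes_realify:
  assumes Y: "commutes_shift Y"
  shows "realify total total Y * real_weyr \<mu> m w = real_weyr \<mu> m w * realify total total Y"
    (is "?X * ?W = ?W * ?X")
proof (rule eq_matI)
  fix p q assume "p < dim_row (?W * ?X)" "q < dim_col (?W * ?X)"
  then have "p < 2 * total" "q < 2 * total" using real_weyr_carrier[of \<mu>] by auto
  then obtain p' e q' f where *: "p' < total" "e < 2" "p = 2 * p' + e" "q' < total" "f < 2" "q = 2 * q' + f"
    by (metis mult_div_mod_eq mod_less_divisor pos2 less_mult_imp_div_less mult.commute)
  obtain i x where i: "i \<in> {1..m}" "x < w i" "p' = pos i x" using offset_cases[OF *(1)] .
  obtain j y where j: "j \<in> {1..m}" "y < w j" "q' = pos j y" using offset_cases[OF *(4)] .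
  have less: "pos i x < total" "pos j y < total" using * i j by simp_all
  have less': "pos (j - 1) y < total" if "1 < j"
    using offset_add_less less_w_pred[OF that j(1,2)] by blast
  have less'': "pos (i + 1) x < total" if "i < m \<and> x < w (i + 1)"
    using offset_add_less[of "i + 1" m x w] that by auto
  let ?L = "if 1 < j then Y (pos i x) (pos (j - 1) y) else 0"
  let ?R = "if i < m \<and> x < w (i + 1) then Y (pos (i + 1) x) (pos j y) else 0"
  have L: "(if 1 < j then ?X $$ (2 * pos i x, 2 * pos (j - 1) y) else 0) = Re ?L"
    "(if 1 < j then ?X $$ (2 * pos i x, 2 * pos (j - 1) y + 1) else 0) = Im ?L"
    "(if 1 < j then ?X $$ (2 * pos i x + 1, 2 * pos (j - 1) y) else 0) = - Im ?L"
    "(if 1 < j then ?X $$ (2 * pos i x + 1, 2 * pos (j - 1) y + 1) else 0) = Re ?L"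
    using realify_index[OF less(1) less'] by auto
  have R: "(if i < m \<and> x < w (i + 1) then ?X $$ (2 * pos (i + 1) x, 2 * pos j y) else 0) = Re ?R"
    "(if i < m \<and> x < w (i + 1) then ?X $$ (2 * pos (i + 1) x, 2 * pos j y + 1) else 0) = Im ?R"
    "(if i < m \<and> x < w (i + 1) then ?X $$ (2 * pos (i + 1) x + 1, 2 * pos j y) else 0) = - Im ?R"
    "(if i < m \<and> x < w (i + 1) then ?X $$ (2 * pos (i + 1) x + 1, 2 * pos j y + 1) else 0) = Re ?R"
    using realify_index[OF less'' less(2)] by auto
  have LR: "?L = ?R"
    using Y[unfolded commutes_shift_def, rule_format, OF i(1) j(1) i(2) j(2)] .
  note entries = realify_index[OF less, unfolded One_nat_def]
  have "e = 0 \<or> e = 1" "f = 0 \<or> f = 1" using * by auto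
  then show "(?X * ?W) $$ (p, q) = (?W * ?X) $$ (p, q)"
    unfolding *(3,6) i(3) j(3)
      commute_real_weyr_entry[OF realify_carrier(1) i(1,2) *(2) j(1,2) *(5)]
    by (elim disjE; hypsubst; unfold add_0_right L R LR)
      (simp_all only: entries cell_index One_nat_def, simp_all add: algebra_simps)
qed (use real_weyr_carrier[of \<mu>] in auto)

text \<open>Let \<open>J = cell 0 1\<close>. By induction, the commutator of a \<open>2 \<times> 2\<close> cell of \<open>X\<close> with \<open>J\<close> is of
  the form \<open>cell c d\<close> and so commutes with \<open>J\<close>; but commutators with \<open>J\<close> anticommute with \<open>J\<close>,
  hence it vanishes.\<close>

lemma commuting_cells:
  assumes im: "Im \<mu> \<noteq> 0" and X: "X \<in> carrier_mat (2 * total) (2 * total)"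
    and comm: "X * real_weyr \<mu> m w = real_weyr \<mu> m w * X"
    and i: "i \<in> {1..m}" "x < w i" and j: "j \<in> {1..m}" "y < w j"
  shows "X $$ (2 * pos i x + 1, 2 * pos j y) = - X $$ (2 * pos i x, 2 * pos j y + 1) \<and>
    X $$ (2 * pos i x + 1, 2 * pos j y + 1) = X $$ (2 * pos i x, 2 * pos j y) \<and>
    (if 1 < j then cx X (2 * pos i x) (pos (j - 1) y) else 0) =
    (if i < m \<and> x < w (i + 1) then cx X (2 * pos (i + 1) x) (pos j y) else 0)"
  using i j
\<comment> \<open>The shifted terms sit in blocks \<open>(i, j - 1)\<close> and
  \<open>(i + 1, j)\<close>, both of smaller measure.\<close>
proof (induction "j + (m - i)" arbitrary: i j rule: less_induct)
  case less
  let ?L = "\<lambda>e f. if 1 < j then X $$ (2 * pos i x + e, 2 * pos (j - 1) y + f) else 0"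
  let ?R = "\<lambda>e f. if i < m \<and> x < w (i + 1) then X $$ (2 * pos (i + 1) x + e, 2 * pos j y + f) else 0"
  have L: "?L 1 0 = - ?L 0 1" "?L 1 1 = ?L 0 0"
  proof -
    have "X $$ (2 * pos i x + 1, 2 * pos (j - 1) y) = - X $$ (2 * pos i x, 2 * pos (j - 1) y + 1) \<and>
      X $$ (2 * pos i x + 1, 2 * pos (j - 1) y + 1) = X $$ (2 * pos i x, 2 * pos (j - 1) y)"
      if "1 < j"
      using less.hyps[OF _ less.prems(1,2) less_w_pred[OF that less.prems(3,4)]] that by auto
    then show "?L 1 0 = - ?L 0 1" "?L 1 1 = ?L 0 0" by auto
  qed
  have R: "?R 1 0 = - ?R 0 1" "?R 1 1 = ?R 0 0"
    using less.hyps[of j "i + 1"] less.prems by auto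
  have eq: "X $$ (2 * pos i x + e, 2 * pos j y) * cell (Re \<mu>) (Im \<mu>) $$ (0, f) +
    X $$ (2 * pos i x + e, 2 * pos j y + 1) * cell (Re \<mu>) (Im \<mu>) $$ (1, f) + ?L e f =
    cell (Re \<mu>) (Im \<mu>) $$ (e, 0) * X $$ (2 * pos i x, 2 * pos j y + f) +
    cell (Re \<mu>) (Im \<mu>) $$ (e, 1) * X $$ (2 * pos i x + 1, 2 * pos j y + f) + ?R e f"
    if "e < 2" "f < 2" for e f
    by (rule iffD1[OF commute_real_weyr_entry[OF X less.prems(1,2) that(1) less.prems(3,4) that(2)]])
      (simp only: comm)
  define a b c d where "a = X $$ (2 * pos i x, 2 * pos j y)" and "b = X $$ (2 * pos i x, 2 * pos j y + 1)"
    and "c = X $$ (2 * pos i x + 1, 2 * pos j y)" and "d = X $$ (2 * pos i x + 1, 2 * pos j y + 1)"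
  note abcd = this
  define l1 l2 r1 r2 where "l1 = ?L 0 0" and "l2 = ?L 0 1" and "r1 = ?R 0 0" and "r2 = ?R 0 1"
  note lr = this
  have e1: "a * Re \<mu> + b * (- Im \<mu>) + l1 = Re \<mu> * a + Im \<mu> * c + r1"
    using eq[of 0 0, folded lr] unfolding abcd by simp
  have e2: "a * Im \<mu> + b * Re \<mu> + l2 = Re \<mu> * b + Im \<mu> * d + r2"
    using eq[of 0 1, folded lr] unfolding abcd by simp
  have e3: "c * Re \<mu> + d * (- Im \<mu>) + - l2 = - Im \<mu> * a + Re \<mu> * c + - r2"
    using eq[of 1 0, unfolded L R, folded lr] unfolding abcd by simp
  have e4: "c * Im \<mu> + d * Re \<mu> + l1 = - Im \<mu> * b + Re \<mu> * d + r1"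
    using eq[of 1 1, unfolded L R, folded lr] unfolding abcd by simp
  \<comment> \<open>\<open>e1\<close> and \<open>e4\<close> express
    \<open>Im \<mu> * (b + c)\<close> as \<open>l1 - r1\<close> and as its negative;
    \<open>e2\<close> and \<open>e3\<close> do the same for \<open>Im \<mu> * (a - d)\<close> and
    \<open>r2 - l2\<close>.\<close>
  have bc: "Im \<mu> * (b + c) = 0"
    using e1 e4 by (simp add: algebra_simps)
  moreover have ad: "Im \<mu> * (a - d) = 0"
    using e2 e3 by (simp only: algebra_simps)
  moreover have "l1 = r1"
    using e1 bc by (simp add: algebra_simps)
  moreover have "l2 = r2"
    using e2 ad by (auto simp: algebra_simps)
  ultimately show ?case
    using im by (auto simp: abcd lr cx_def complex_eq_iff)
qed

lemma commuting_imp_realify: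
  assumes im: "Im \<mu> \<noteq> 0" and X: "X \<in> carrier_mat (2 * total) (2 * total)"
    and comm: "X * real_weyr \<mu> m w = real_weyr \<mu> m w * X"
  obtains Y where "X = realify total total Y" "commutes_shift Y"
proof
  \<comment> \<open>The even rows carry the complex entries; the cell shape then determines the odd
    rows.\<close>
  let ?Y = "\<lambda>p. cx X (2 * p)"
  note cells = commuting_cells[OF assms]
  show "X = realify total total ?Y"
  proof (rule realify_eqI[OF X])
    fix p q assume pq: "p < total" "q < total"
    obtain i x where i: "i \<in> {1..m}" "x < w i" "p = pos i x" using offset_cases[OF pq(1)] .
    obtain j y where j: "j \<in> {1..m}" "y < w j" "q = pos j y" using offset_cases[OF pq(2)] .
    show "X $$ (2 * p, 2 * q) = Re (?Y p q) \<and> X $$ (2 * p, 2 * q + 1) = Im (?Y p q) \<and>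
        X $$ (2 * p + 1, 2 * q) = - Im (?Y p q) \<and> X $$ (2 * p + 1, 2 * q + 1) = Re (?Y p q)"
      using cells[OF i(1,2) j(1,2)] unfolding i(3) j(3) cx_def by simp
  qed
  show "commutes_shift ?Y"
    unfolding commutes_shift_def using cells by blast
qed

subsection \<open>Reduced forms\<close>

lemma offset_tau_diff:
  assumes "i \<le> m"
  shows "offset (tau_diff m w) (Suc i) = tau m w i"
  using assms
proof (induction i)
  case 0
  then show ?case by (simp add: offset_one tau_def)
next
  case (Suc i)
  \<comment> \<open>Monotonicity lets the sum of truncated differences telescope.\<close>
  have "tau m w i \<le> tau m w (Suc i)"
  proof (cases "i = 0")
    case False
    then have "w (m - i + 1) \<le> w (m - i)"
      using Suc.prems by (intro w_antimono) auto
    then show ?thesis using Suc.prems False by (simp add: tau_def Suc_diff_Suc)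
  qed (simp add: tau_def)
  then show ?case using Suc by (simp add: offset_Suc tau_diff_def)
qed

text \<open>Block \<open>i\<close> is the range from \<open>w (m - i + 2)\<close> (from 0 if
  \<open>i = 1\<close>) up to \<open>w (m - i + 1)\<close>. Thus the partition used for reduced
  forms is the one into level sets of \<open>height\<close>.\<close>

lemma height_offset_tau_diff:
  assumes i: "i \<in> {1..m}" and x: "x < tau_diff m w i"
  shows "height (offset (tau_diff m w) i + x) = m + 1 - i"
proof -
  let ?x = "offset (tau_diff m w) i + x"
  have "?x < offset (tau_diff m w) (Suc i)" using i x by (simp add: offset_Suc)
  also have "\<dots> = w (m - i + 1)" using offset_tau_diff[of i] i by (simp add: tau_def)
  finally have "m - i + 1 \<le> height ?x" using less_w_iff[of "m - i + 1" ?x] i by auto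
  moreover have "height ?x < m - i + 2"
  proof (cases "i = 1")
    case True
    then show ?thesis using height_le[of ?x] m_pos by simp
  next
    case False
    then have "offset (tau_diff m w) i = w (m - i + 2)"
    proof -
      have "i - 1 \<le> m" "Suc (i - 1) = i" "m - (i - 1) + 1 = m - i + 2" "i - 1 \<noteq> 0"
        using i False by auto
      then show ?thesis using offset_tau_diff[of "i - 1"] by (simp only: tau_def if_False)
    qed
    then have "\<not> ?x < w (m - i + 2)" by simp
    moreover have "m - i + 2 \<in> {1..m}" using i False by auto
    ultimately show ?thesis using less_w_iff[of "m - i + 2" ?x] by simp
  qed
  ultimately show ?thesis using i by auto
qed

lemma red_block_carrier:
  "red_block m w \<I> R j i l \<in> carrier_mat (tau_diff m w i) (2 * tau_diff m w l)"
  if "1 \<le> i" "1 \<le> l"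
  using that by (simp add: red_block_def block_def submat_def block_range_def offset_Suc)

lemma offset_tau_diff_less:
  assumes "i \<in> {1..m}" "x < tau_diff m w i" "j \<in> {1..m}" "i \<le> m - j + 1"
  shows "offset (tau_diff m w) i + x < w j"
proof -
  have "j \<le> m + 1 - i" using assms(1,3,4) by auto
  then show ?thesis
    unfolding less_w_iff[OF assms(3)] height_offset_tau_diff[OF assms(1,2)] .
qed

text \<open>The first row block starts at row 0, so an index below \<open>r 1\<close> names the same
  row in \<open>R\<close> and in that block; \<open>l \<le> m - j + 1\<close> keeps the column
  inside block \<open>j\<close>.\<close>

lemma cx_red_block:
  assumes len: "length (\<I> m) = w 1" and \<I>: "set (\<I> m) \<subseteq> {..<r 1}"
    and R: "R \<in> carrier_mat n (2 * total)"
    and i: "i \<in> {1..m}" "x < tau_diff m w i" and l: "l \<in> {1..m}" "y < tau_diff m w l"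
    and j: "j \<in> {1..m}" "l \<le> m - j + 1"
  shows "cx (red_block m w \<I> (row_block r R 1) j i l) x y =
    cx R (\<I> m ! (offset (tau_diff m w) i + x)) (pos j (offset (tau_diff m w) l + y))"
proof -
  let ?d = "tau_diff m w"
  let ?x = "offset ?d i + x" and ?y = "offset ?d l + y"
  have x: "?x < w 1" using offset_tau_diff_less[of i x 1] i m_pos by simp
  have y: "?y < w j" using offset_tau_diff_less[OF l j] .
  have Ix: "\<I> m ! ?x < r 1" using \<I> len x by (auto simp: subset_iff)
  have total: "pos j ?y < total" using offset_add_less[of j m ?y w] j y by blast
  have "red_block m w \<I> (row_block r R 1) j i l $$ (x, 2 * y + f) =
      R $$ (\<I> m ! ?x, 2 * pos j ?y + f)" if "f < 2" for f
  proof -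
    have "2 * y + f < 2 * ?d l" "2 * ?y + f < 2 * w j" "2 * pos j ?y + f < 2 * total"
      using that l y total by auto
    then show ?thesis
      using i l j x len Ix R
      by (simp add: red_block_def block_def submat_def block_range_def row_block_def offset_Suc
          offset_double offset_one add.assoc)
  qed
  from this[of 0] this[of 1] show ?thesis by (simp add: cx_def)
qed

lemma tau_block_cases:
  assumes "x < w 1"
  obtains i x' where "i \<in> {1..m}" "x' < tau_diff m w i" "x = offset (tau_diff m w) i + x'"
proof -
  have "x < offset (tau_diff m w) (Suc m)"
    using assms offset_tau_diff[of m] m_pos by (simp add: tau_def)
  from offset_cases[OF this] that show ?thesis by blast
qed

text \<open>For \<open>x\<close> in block \<open>i\<close> and \<open>y\<close> in block
  \<open>l\<close> the heights are \<open>m + 1 - i\<close> and \<open>m + 1 - l\<close>, so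
  \<open>height y < height x + j\<close> means \<open>i < l + j\<close>. For \<open>j = 1\<close>
  this is \<open>i \<le> l\<close>, the identity blocks and the zeros to their right; for
  \<open>j \<ge> 2\<close> it is the lower bound on the block column in
  \<open>reduced_form\<close>.\<close>

lemma reduced_form_iff:
  assumes len: "length (\<I> m) = w 1" and \<I>: "set (\<I> m) \<subseteq> {..<r 1}"
  shows "reduced_form \<mu> m w k r \<I> R \<longleftrightarrow> R \<in> obs_mats (real_weyr \<mu> m w) k r \<and>
    (\<forall>x<w 1. \<forall>j\<in>{1..m}. \<forall>y<w j. height y < height x + j \<longrightarrow>
      cx R (\<I> m ! x) (pos j y) = (if j = 1 \<and> x = y then 1 else 0))"
proof (cases "R \<in> obs_mats (real_weyr \<mu> m w) k r")
  case True
  let ?d = "tau_diff m w" and ?R = "red_block m w \<I> (row_block r R 1)"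
  let ?p = "\<lambda>i x. offset ?d i + x"
  have R: "R \<in> carrier_mat (\<Sum>i = 1..k. r i) (2 * total)"
    using True real_weyr_carrier[of \<mu>] by (simp add: obs_mats_def)
  note cx = cx_red_block[of \<I> r, OF len \<I> R]
  have one: "diamond (?R 1 i i) = 1\<^sub>m (2 * ?d i) \<longleftrightarrow> (\<forall>x<?d i. \<forall>y<?d i.
      cx R (\<I> m ! ?p i x) (pos 1 (?p i y)) = (if ?p i x = ?p i y then 1 else 0))"
    if i: "i \<in> {1..m}" for i
    using cx[OF i _ i, of _ _ 1] i m_pos
    by (subst diamond_eq_realify[OF red_block_carrier]) (auto simp: one_mat_eq_realify realify_eq_iff)
  have zero: "diamond (?R j i l) = 0\<^sub>m (2 * ?d i) (2 * ?d l) \<longleftrightarrow>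
      (\<forall>x<?d i. \<forall>y<?d l. cx R (\<I> m ! ?p i x) (pos j (?p l y)) = 0)"
    if i: "i \<in> {1..m}" and l: "l \<in> {1..m}" and j: "j \<in> {1..m}" "l \<le> m - j + 1" for i j l
    using cx[OF i _ l _ j] i l
    by (subst diamond_eq_realify[OF red_block_carrier]) (auto simp: zero_mat_eq_realify realify_eq_iff)
  show ?thesis
  proof
    assume red: "reduced_form \<mu> m w k r \<I> R"
    have "cx R (\<I> m ! x) (pos j y) = (if j = 1 \<and> x = y then 1 else 0)"
      if x: "x < w 1" and j: "j \<in> {1..m}" and y: "y < w j" and h: "height y < height x + j" for x j y
    proof -
      obtain i x' where i: "i \<in> {1..m}" "x' < ?d i" "x = ?p i x'" using tau_block_cases[OF x] .
      have y1: "y < w 1" using less_w_mono[OF y, of 1] j by auto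
      obtain l y' where l: "l \<in> {1..m}" "y' < ?d l" "y = ?p l y'"
        using tau_block_cases[OF y1] .
      have hx: "height x = m + 1 - i" "height y = m + 1 - l"
        using height_offset_tau_diff i l by auto
      have lj: "l \<le> m - j + 1" using less_w_iff[OF j, of y] y hx l by auto
      have il: "i < l + j" using h hx i l by auto
      consider "j = 1" "i = l" | "j = 1" "i < l" | "2 \<le> j" using j il by fastforce
      then show ?thesis
      proof cases
        case 1
        then have "diamond (?R 1 i i) = 1\<^sub>m (2 * ?d i)"
          using red i by (auto simp: reduced_form_def Let_def)
        then show ?thesis using one[OF i(1)] i l 1 by auto
      next
        case 2
        then have "diamond (?R 1 i l) = 0\<^sub>m (2 * ?d i) (2 * ?d l)"
          using red i l by (auto simp: reduced_form_def Let_def)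
        moreover have "x \<noteq> y" using 2 hx i l by auto
        ultimately show ?thesis using zero[OF i(1) l(1) j lj] i l 2 by auto
      next
        case 3
        then have "j \<in> {2..m}" "l \<in> {max (i + 1 - j) 1..m - j + 1}"
          using j lj il l by auto
        then have "diamond (?R j i l) = 0\<^sub>m (2 * ?d i) (2 * ?d l)"
          using red i by (auto simp: reduced_form_def Let_def)
        then show ?thesis using zero[OF i(1) l(1) j lj] i l 3 by auto
      qed
    qed
    with True show "R \<in> obs_mats (real_weyr \<mu> m w) k r \<and>
      (\<forall>x<w 1. \<forall>j\<in>{1..m}. \<forall>y<w j. height y < height x + j \<longrightarrow>
        cx R (\<I> m ! x) (pos j y) = (if j = 1 \<and> x = y then 1 else 0))" by blast
  next
    assume "R \<in> obs_mats (real_weyr \<mu> m w) k r \<and>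
      (\<forall>x<w 1. \<forall>j\<in>{1..m}. \<forall>y<w j. height y < height x + j \<longrightarrow>
        cx R (\<I> m ! x) (pos j y) = (if j = 1 \<and> x = y then 1 else 0))"
    then have entry: "cx R (\<I> m ! ?p i x) (pos j (?p l y)) = (if j = 1 \<and> ?p i x = ?p l y then 1 else 0)"
      if "i \<in> {1..m}" "l \<in> {1..m}" "j \<in> {1..m}" "x < ?d i" "y < ?d l" "l \<le> m - j + 1" "i < l + j"
      for i j l x y
      using that offset_tau_diff_less[of i x 1] offset_tau_diff_less[of l y j] m_pos
        height_offset_tau_diff[of i x] height_offset_tau_diff[of l y] by auto
    \<comment> \<open>Different blocks have different heights, so no prescribed entry outside the
      diagonal blocks is 1.\<close>
    have ne: "?p i x \<noteq> ?p l y"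
      if "i \<in> {1..m}" "l \<in> {1..m}" "x < ?d i" "y < ?d l" "i \<noteq> l" for i l x y
      using that height_offset_tau_diff[of i x] height_offset_tau_diff[of l y] by auto
    have "diamond (?R 1 i i) = 1\<^sub>m (2 * ?d i)" if "i \<in> {1..m}" for i
      using entry[of i i 1] that m_pos by (subst one) auto
    moreover have "diamond (?R 1 i l) = 0\<^sub>m (2 * ?d i) (2 * ?d l)"
      if "i \<in> {1..m}" "l \<in> {i<..m}" for i l
      using entry[of i l 1] ne[of i l] that m_pos by (subst zero) auto
    moreover have "diamond (?R j i l) = 0\<^sub>m (2 * ?d i) (2 * ?d l)"
      if "j \<in> {2..m}" "i \<in> {1..m}" "l \<in> {max (i + 1 - j) 1..m - j + 1}" for i j l
      using entry[of i l j] that by (subst zero) auto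
    ultimately show "reduced_form \<mu> m w k r \<I> R"
      using True unfolding reduced_form_def Let_def by blast
  qed
qed (simp add: reduced_form_def)

text \<open>\<open>tau\<close> reverses the order of \<open>w\<close> and the index lists are
  nested, so the first \<open>w t\<close> entries of the last list form the list numbered
  \<open>m - t + 1\<close>; its invertible block then has trivial kernel.\<close>

lemma admissible_leading_injective:
  assumes adm: "admissible m w r P \<I>" and P: "P \<in> carrier_mat n (2 * total)"
  shows "leading_injective (\<lambda>x. cx P (\<I> m ! x))"
  unfolding leading_injective_def
proof (intro ballI)
  fix t assume t: "t \<in> {1..m}"
  define j where "j = m - t + 1"
  have j: "j \<in> {1..m}" "tau m w j = w t" using t by (auto simp: j_def tau_def)
  have "i \<le> m \<Longrightarrow> 1 \<le> i \<Longrightarrow> prefix (\<I> i) (\<I> m)" for i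
  proof (induction rule: inc_induct)
    case (step i)
    then have "prefix (\<I> i) (\<I> (i + 1))"
      using adm by (auto simp: admissible_def)
    with step show ?case by (auto intro: prefix_order.trans)
  qed simp
  then have prefix: "prefix (\<I> j) (\<I> m)" using j by simp
  have len: "length (\<I> j) = w t" using adm j by (auto simp: admissible_def)
  have I: "\<I> j ! x = \<I> m ! x" if "x < w t" for x
    using prefix len that by (auto simp: prefix_def nth_append)
  let ?S = "submat P (\<I> j) [0..<2 * w t]"
  have S: "?S \<in> carrier_mat (w t) (2 * w t)" by (simp add: submat_def len)
  have "invertible_mat (diamond ?S)" using adm j(1) by (auto simp: admissible_def j(2)[symmetric])
  moreover have "diamond ?S = realify (w t) (w t) (\<lambda>x. cx P (\<I> m ! x))"
    unfolding diamond_eq_realify[OF S]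
    by (rule realify_cong) (simp add: cx_def submat_def len I)
  ultimately have "det (realify (w t) (w t) (\<lambda>x. cx P (\<I> m ! x))) \<noteq> 0"
    using invertible_mat_iff_det[OF realify_carrier(1)] by simp
  then show "\<forall>u. (\<forall>x<w t. (\<Sum>z<w t. cx P (\<I> m ! x) z * u z) = 0) \<longrightarrow> (\<forall>z<w t. u z = 0)"
    by (simp only: det_realify_nonzero_iff)
qed

end

section \<open>Existence and uniqueness of the reduced form\<close>

theorem theorem5p16:
  fixes \<mu> :: complex and m k :: nat and w r :: "nat \<Rightarrow> nat"
    and P :: "real mat" and \<I> :: "nat \<Rightarrow> nat list"
  assumes "\<mu> \<notin> \<real>"
    and "noninc_pos_seq m w"
    and "noninc_pos_seq k r"
    and "obs_mats (real_weyr \<mu> m w) k r \<noteq> {}"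
    and "P \<in> obs_mats (real_weyr \<mu> m w) k r"
    and "admissible m w (r 1) P \<I>"
  shows "\<exists>!R. reduced_form \<mu> m w k r \<I> R \<and> centralizer_equiv (real_weyr \<mu> m w) P R"
proof -
  interpret weyr_char m w using assms(2) by unfold_locales
  let ?W = "real_weyr \<mu> m w" and ?n = "\<Sum>i = 1..k. r i"
  let ?a = "\<lambda>x. cx P (\<I> m ! x)"
  have im: "Im \<mu> \<noteq> 0" using assms(1) complex_is_Real_iff by blast
  note W = real_weyr_carrier[of \<mu>]
  have P: "P \<in> carrier_mat ?n (2 * total)"
    using assms(5) W by (simp add: obs_mats_def)
  have len: "length (\<I> m) = w 1" and \<I>: "set (\<I> m) \<subseteq> {..<r 1}"
    using assms(6) m_pos by (auto simp: admissible_def tau_def)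
  have "r 1 \<le> ?n" using assms(3) by (intro member_le_sum) (auto simp: noninc_pos_seq_def)
  have Ix: "\<I> m ! x < ?n" if "x < w 1" for x
  proof -
    have "\<I> m ! x \<in> {..<r 1}" using \<I> len that by (intro subsetD[OF \<I>] nth_mem) simp
    then show ?thesis using \<open>r 1 \<le> ?n\<close> by simp
  qed
  have inj: "leading_injective ?a"
    by (rule admissible_leading_injective[OF assms(6) P])
  \<comment> \<open>At the selected rows, products with \<open>P\<close> become the complex sums of
    the systems solved above.\<close>
  have entry: "cx (P * realify total total Y) (\<I> m ! x) (pos j y) = (\<Sum>p<total. ?a x p * Y p (pos j y))"
    if "x < w 1" "j \<in> {1..m}" "y < w j" for Y x j y
    using mult_realify_index[OF P Ix[OF that(1)]] offset_add_less[of j m y w] that by blast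
  show ?thesis
  proof (rule ex_ex1I)
    \<comment> \<open>The multiplier comes from solving with the pattern of the reduced form as
      right-hand side.\<close>
    obtain Y where Y: "commutes_shift Y"
      and norm: "\<And>x j y. x < w 1 \<Longrightarrow> j \<in> {1..m} \<Longrightarrow> y < w j \<Longrightarrow> height y < height x + j \<Longrightarrow>
        (\<Sum>p<total. ?a x p * Y p (pos j y)) = (if j = 1 \<and> x = y then 1 else 0)"
      using commutes_shift_exists[OF inj, of "\<lambda>x j y. if j = 1 \<and> x = y then 1 else 0"] by blast
    let ?X = "realify total total Y"
    have "det ?X \<noteq> 0"
      unfolding det_realify_nonzero_iff using commutes_shift_injective[OF Y norm] by blast
    then have X: "?X \<in> centralizer_group ?W"
      using W commutes_realify[OF Y] invertible_mat_iff_det[OF realify_carrier(1)]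
      by (simp add: centralizer_group_def)
    then have "P * ?X \<in> obs_mats ?W k r"
      by (rule obs_mats_mult[OF assms(3,5) W])
    then have "reduced_form \<mu> m w k r \<I> (P * ?X)"
      unfolding reduced_form_iff[of \<I> r, OF len \<I>] using entry norm by simp
    then show "\<exists>R. reduced_form \<mu> m w k r \<I> R \<and> centralizer_equiv ?W P R"
      using X by (auto simp: centralizer_equiv_def)
  next
    fix R R'
    assume R: "reduced_form \<mu> m w k r \<I> R \<and> centralizer_equiv ?W P R"
      and R': "reduced_form \<mu> m w k r \<I> R' \<and> centralizer_equiv ?W P R'"
    \<comment> \<open>Here it matters that \<open>\<mu>\<close> is not real: every multiplier must
      be a realification.\<close>
    have realify: "\<exists>Y. commutes_shift Y \<and> R = P * realify total total Y"
      if equiv: "centralizer_equiv ?W P R" for R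
    proof -
      obtain X where "X \<in> carrier_mat (2 * total) (2 * total)" "X * ?W = ?W * X" "R = P * X"
        using equiv W by (auto simp: centralizer_equiv_def centralizer_group_def)
      then show ?thesis using commuting_imp_realify[OF im] by metis
    qed
    obtain Y where Y: "commutes_shift Y" "R = P * realify total total Y" using realify R by blast
    obtain Y' where Y': "commutes_shift Y'" "R' = P * realify total total Y'" using realify R' by blast
    \<comment> \<open>Both reduced forms share the prescribed entries, so the difference of the
      multipliers solves the homogeneous problem.\<close>
    have "Y p q - Y' p q = 0" if "p < total" "q < total" for p q
    proof (rule commutes_shift_zero[OF inj commutes_shift_diff[OF Y(1) Y'(1)] _ that])
      fix x j y assume *: "x < w 1" "j \<in> {1..m}" "y < w j" "height y < height x + j"
      then have "cx R (\<I> m ! x) (pos j y) = cx R' (\<I> m ! x) (pos j y)"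
        using R R' unfolding reduced_form_iff[of \<I> r, OF len \<I>] by simp
      then show "(\<Sum>p<total. ?a x p * (Y p (pos j y) - Y' p (pos j y))) = 0"
        using entry[OF *(1-3)] by (simp add: Y(2) Y'(2) right_diff_distrib sum_subtractf)
    qed
    then have "realify total total Y = realify total total Y'"
      by (intro realify_cong) simp
    then show "R = R'" using Y(2) Y'(2) by simp
  qed
qed

end
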